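(* In the model where acknowledgements of successful transmissions are provided to the sender, there is a deterministic information gathering protocol for ad-hoc radio networks with tree topology, without rumor aggregation, that runs in time $O(n)$: for every tree $\mathcal{T}$ with $n$ nodes and every assignment of distinct labels from $\{0,1,\dots,n-1\}$ to its nodes, all rumors are delivered to the root within $O(n)$ steps.
   Context: The network is a rooted tree $\mathcal{T}$ with $n$ nodes whose edges are directed towards the root $r$; a node can send messages only to its parent. Each node has a unique label in $\{0,1,\dots,n-1\}$, and initially each node $v$ holds a piece of information $\rho_v$ (its rumor). Computation proceeds in synchronous discrete time steps. At each step each node is either in the receiving state or in the transmitting state. A transmitted message goes to the node's parent; the parent $w$ receives it if and only if $w$ is in the receiving state and no other child of $w$ transmits in the same step (otherwise a collision occurs and nothing is received). No aggregation: each message contains at most one rumor plus $O(\log n)$ additional bits. Acknowledgements: after each successful transmission, the sender (and only the sender) is notified that its message was received; all other nodes, including the intended recipient, cannot distinguish a collision from the absence of transmissions. The topology is unknown to the nodes. A deterministic gathering protocol specifies, for each node and each time step, the node's action as a function only of $n$, its label and the information (messages and acknowledgements) it has received so far. A protocol runs in time $T(n)$ if for every tree and every labeling, all rumors are in the root after at most $T(n)$ steps. *)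

theory Defs
  imports Complex_Main "HOL-Library.Landau_Symbols"
begin

text \<open>A finite tree with all edges directed towards the root; \<open>(v, w) \<in> E\<close> means that
  \<open>w\<close> is the parent of \<open>v\<close>. Reachability of the root together with uniqueness of parents
  excludes cycles.\<close>

definition rooted_tree :: "'v set \<Rightarrow> ('v \<times> 'v) set \<Rightarrow> 'v \<Rightarrow> bool" where
  "rooted_tree V E r \<longleftrightarrow>
     finite V \<and> r \<in> V \<and> E \<subseteq> V \<times> V \<and>
     r \<notin> Domain E \<and>
     (\<forall>v\<in>V - {r}. \<exists>!w. (v, w) \<in> E) \<and>
     (\<forall>v\<in>V. (v, r) \<in> E\<^sup>*)"

definition radio_network ::
    "nat \<Rightarrow> 'v set \<Rightarrow> ('v \<times> 'v) set \<Rightarrow> 'v \<Rightarrow> ('v \<Rightarrow> nat) \<Rightarrow> bool" where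
  "radio_network n V E r lab \<longleftrightarrow>
     rooted_tree V E r \<and> card V = n \<and> inj_on lab V \<and> lab ` V \<subseteq> {..<n}"

text \<open>A message carries at most one rumor together with a string of additional bits.\<close>

type_synonym 'r message = "'r option \<times> bool list"

text \<open>A protocol is not given the node's own rumor, so an action refers to it by name. Other
  rumors can only be forwarded once they have been received, see \<open>admissible\<close>.\<close>

datatype 'r payload = No_Rumor | Own_Rumor | Relay 'r

datatype 'r action = Receive | Transmit "'r payload" "bool list"

text \<open>What a node learns from one step. \<open>Heard None\<close> stands for silence and for a collision
  alike; \<open>Ack False\<close> is the absence of an acknowledgement.\<close>

datatype 'r feedback = Heard "'r message option" | Ack bool

text \<open>The action of a node is determined by \<open>n\<close>, its label and the feedback of all earlier steps
  in chronological order. Its own earlier actions can be recomputed from these data.\<close>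

type_synonym 'r protocol = "nat \<Rightarrow> nat \<Rightarrow> 'r feedback list \<Rightarrow> 'r action"

fun message_of :: "'r \<Rightarrow> 'r action \<Rightarrow> 'r message option" where
  "message_of own Receive = None"
| "message_of own (Transmit No_Rumor bs) = Some (None, bs)"
| "message_of own (Transmit Own_Rumor bs) = Some (Some own, bs)"
| "message_of own (Transmit (Relay x) bs) = Some (Some x, bs)"

text \<open>In a step with actions \<open>a\<close>, the transmission of \<open>u\<close> is received by its parent \<open>w\<close>.\<close>

definition delivered :: "('v \<times> 'v) set \<Rightarrow> ('v \<Rightarrow> 'r action) \<Rightarrow> 'v \<Rightarrow> 'v \<Rightarrow> bool" where
  "delivered E a u w \<longleftrightarrow>
     (u, w) \<in> E \<and> a u \<noteq> Receive \<and> a w = Receive \<and>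
     (\<forall>u'. (u', w) \<in> E \<and> a u' \<noteq> Receive \<longrightarrow> u' = u)"

definition feedback_of ::
    "('v \<times> 'v) set \<Rightarrow> ('v \<Rightarrow> 'r) \<Rightarrow> ('v \<Rightarrow> 'r action) \<Rightarrow> 'v \<Rightarrow> 'r feedback" where
  "feedback_of E \<rho> a v =
     (case a v of
        Receive \<Rightarrow>
          Heard (if \<exists>u. delivered E a u v
                 then let u = (THE u. delivered E a u v) in message_of (\<rho> u) (a u)
                 else None)
      | Transmit p bs \<Rightarrow> Ack (\<exists>w. delivered E a v w))"

text \<open>\<open>history P n E lab \<rho> t v\<close> is the feedback obtained by \<open>v\<close> in the first \<open>t\<close> steps.\<close>

primrec history ::
    "'r protocol \<Rightarrow> nat \<Rightarrow> ('v \<times> 'v) set \<Rightarrow> ('v \<Rightarrow> nat) \<Rightarrow> ('v \<Rightarrow> 'r) \<Rightarrow>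
     nat \<Rightarrow> 'v \<Rightarrow> 'r feedback list" where
  "history P n E lab \<rho> 0 = (\<lambda>v. [])"
| "history P n E lab \<rho> (Suc t) =
     (\<lambda>v. history P n E lab \<rho> t v @
          [feedback_of E \<rho> (\<lambda>u. P n (lab u) (history P n E lab \<rho> t u)) v])"

definition rumors_at ::
    "'r protocol \<Rightarrow> nat \<Rightarrow> ('v \<times> 'v) set \<Rightarrow> ('v \<Rightarrow> nat) \<Rightarrow> ('v \<Rightarrow> 'r) \<Rightarrow>
     nat \<Rightarrow> 'v \<Rightarrow> 'r set" where
  "rumors_at P n E lab \<rho> t v =
     insert (\<rho> v) {x. \<exists>bs. Heard (Some (Some x, bs)) \<in> set (history P n E lab \<rho> t v)}"

text \<open>In the run on the given network, every transmitted message has at most \<open>b\<close> additional bits,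
  and its rumor, if any, is one that the sender holds.\<close>

definition admissible ::
    "'r protocol \<Rightarrow> nat \<Rightarrow> nat \<Rightarrow> 'v set \<Rightarrow> ('v \<times> 'v) set \<Rightarrow> ('v \<Rightarrow> nat) \<Rightarrow> ('v \<Rightarrow> 'r) \<Rightarrow>
     bool" where
  "admissible P b n V E lab \<rho> \<longleftrightarrow>
     (\<forall>t. \<forall>v\<in>V. \<forall>p bs.
        P n (lab v) (history P n E lab \<rho> t v) = Transmit p bs \<longrightarrow>
          length bs \<le> b \<and>
          (\<forall>x. p = Relay x \<longrightarrow> x \<in> rumors_at P n E lab \<rho> t v))"

end

theory Submission
  imports Defs "HOL-Library.FuncSet" "HOL-Library.Log_Nat"
begin

text \<open>After \<open>n\<close> steps in which the nodes transmit in turn, every node knows the number of its children.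
  Put \<open>v\<close> into class \<open>K\<close> if \<open>2 ^ K / 2 < s \<le> 2 ^ K\<close>, where \<open>s\<close> is the size of the subtree of \<open>v\<close>.
  A node has at most one child of its own class, so each class consists of vertical paths.
  Stage \<open>K\<close> brings all rumors below a node of class \<open>K\<close> to that node. First the children of smaller
  class, who already hold everything below them, compete for their parent. They hold at most \<open>2 ^ K\<close>
  rumors in total, and acknowledgements let rumors that got through drop out, so a fixed sequence of
  \<open>O(2 ^ K * (log (n / 2 ^ K) + 1))\<close> label sets, which exists by counting, delivers all of them
  (Komlos and Greenberg). Then the rumors stream up the paths of class \<open>K\<close> in \<open>O(2 ^ K)\<close> steps. The
  lengths of the stages sum to \<open>O(n)\<close>. Subtree sizes travel with the first message of each node.\<close>

subsection \<open>Contention resolution\<close>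

text \<open>A node does not know its class when the stage of that class begins. It learns its size
  once every child has sent a first message, and the initial steps tell it how many such messages to
  await. For a node of class \<open>K\<close>, the children of smaller class have all reported by
  the end of the contention of stage \<open>K\<close>; a child of the same class reports when it
  first sends in the flow. This also settles the timing on a path whose shape nobody knows. A
  transmitting node cannot receive, so neighbours on a path must transmit at opposite parities.
  Counting steps from the arrival of the last report achieves this: the report of the lower node
  wakes the upper one exactly one step later. The contention bound has
  \<open>log (n / 2 ^ K)\<close> in place of \<open>log n\<close> because it comes from counting the
  sets of \<open>2 ^ K\<close> labels among about \<open>n\<close>. This makes the stage lengths
  behave like a geometric series dominated by the largest classes, which removes the logarithm from
  the total.\<close>

definition collides :: "('a \<Rightarrow> 'b) \<Rightarrow> 'a set \<Rightarrow> 'a \<Rightarrow> bool" where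
  "collides f X x \<longleftrightarrow> (\<exists>y\<in>X. y \<noteq> x \<and> f y = f x)"

text \<open>Encode \<open>f\<close> by its values outside \<open>Z\<close> and, for each
  \<open>z\<close> in \<open>Z\<close>, a partner in \<open>X - Z\<close> with the same value; these
  data determine \<open>f\<close>. For a uniformly random \<open>f\<close> the event thus has
  probability at most \<open>(card X / m) ^ card Z\<close>.\<close>

lemma card_maps_absorbed_le:
  fixes N m :: nat
  assumes X: "X \<subseteq> {..<N}" and Z: "Z \<subseteq> X"
  shows "card {f \<in> {..<N} \<rightarrow>\<^sub>E {..<m}. f ` Z \<subseteq> f ` (X - Z)} \<le> m ^ (N - card Z) * card X ^ card Z"
proof -
  let ?B = "{f \<in> {..<N} \<rightarrow>\<^sub>E {..<m}. f ` Z \<subseteq> f ` (X - Z)}"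
  let ?p = "\<lambda>f z. SOME y. y \<in> X - Z \<and> f y = f z"
  let ?c = "\<lambda>f. (restrict f ({..<N} - Z), restrict (?p f) Z)"
  have finX: "finite X" using X finite_subset by blast
  have finZ: "finite Z" using finX Z finite_subset by blast
  have p: "?p f z \<in> X - Z \<and> f (?p f z) = f z" if "f \<in> ?B" "z \<in> Z" for f z
  proof -
    from that have "f z \<in> f ` (X - Z)" by blast
    then have "\<exists>y. y \<in> X - Z \<and> f y = f z" by (metis imageE)
    then show ?thesis by (rule someI_ex)
  qed
  have inj: "inj_on ?c ?B"
  proof (rule inj_onI)
    fix f g assume f: "f \<in> ?B" and g: "g \<in> ?B" and eq: "?c f = ?c g"
    have out: "f a = g a" if "a \<in> {..<N} - Z" for a
      using eq that by (metis (no_types, lifting) prod.inject restrict_apply')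
    have "f a = g a" if "a \<in> {..<N}" for a
    proof (cases "a \<in> Z")
      case True
      have same: "?p f a = ?p g a"
        using eq True by (metis (no_types, lifting) prod.inject restrict_apply')
      have "?p f a \<in> {..<N} - Z" using p[OF f True] X by blast
      then show ?thesis using p[OF f True] p[OF g True] out same by metis
    qed (use out that in blast)
    then show "f = g" using f g by (intro PiE_ext[of f "{..<N}" "\<lambda>_. {..<m}" g]) auto
  qed
  have "?c ` ?B \<subseteq> (({..<N} - Z) \<rightarrow>\<^sub>E {..<m}) \<times> (Z \<rightarrow>\<^sub>E X)"
  proof (rule image_subsetI)
    fix f assume f: "f \<in> ?B"
    have "restrict f ({..<N} - Z) \<in> ({..<N} - Z) \<rightarrow>\<^sub>E {..<m}" using f by auto
    moreover have "restrict (?p f) Z \<in> Z \<rightarrow>\<^sub>E X" using p[OF f] by auto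
    ultimately show "?c f \<in> (({..<N} - Z) \<rightarrow>\<^sub>E {..<m}) \<times> (Z \<rightarrow>\<^sub>E X)" by blast
  qed
  moreover have "finite ((({..<N} - Z) \<rightarrow>\<^sub>E {..<m}) \<times> (Z \<rightarrow>\<^sub>E X))"
    using finX finZ by (intro finite_cartesian_product finite_PiE) auto
  ultimately have "card ?B \<le> card ((({..<N} - Z) \<rightarrow>\<^sub>E {..<m}) \<times> (Z \<rightarrow>\<^sub>E X))"
    using inj card_inj_on_le by blast
  also have "\<dots> = m ^ (N - card Z) * card X ^ card Z"
  proof -
    have "card ({..<N} - Z) = N - card Z" using X Z finZ by (subst card_Diff_subset) auto
    then show ?thesis using finZ by (simp add: card_cartesian_product card_PiE)
  qed
  finally show ?thesis .
qed

text \<open>\<open>Z\<close> consists of all elements of \<open>X\<close> but one from each fibre of \<open>f\<close>.\<close>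

lemma colliding_imp_absorbed:
  assumes X: "finite X" and R: "R \<subseteq> X" "card X \<le> 2 * card R" and c: "\<forall>x\<in>R. collides f X x"
  obtains Z where "Z \<subseteq> X" "card X \<le> 4 * card Z" "f ` Z \<subseteq> f ` (X - Z)"
proof -
  obtain W where W: "W \<subseteq> X" "inj_on f W" "f ` X = f ` W"
    by (metis subset_image_inj subset_refl)
  \<comment> \<open>\<open>q\<close> picks another element of the same fibre. For an element of the
    transversal \<open>W\<close> this partner lies outside \<open>W\<close> and determines the
    fibre, so \<open>R \<inter> W\<close> and \<open>R - W\<close> both embed into
    \<open>X - W\<close>. Together with the bound on \<open>R\<close> this gives the factor
    4.\<close>
  define q where "q x = (SOME y. y \<in> X \<and> y \<noteq> x \<and> f y = f x)" for x
  have q: "q x \<in> X" "q x \<noteq> x" "f (q x) = f x" if "x \<in> R" for x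
  proof -
    have "\<exists>y. y \<in> X \<and> y \<noteq> x \<and> f y = f x" using c that unfolding collides_def by blast
    from someI_ex[OF this] show "q x \<in> X" "q x \<noteq> x" "f (q x) = f x" unfolding q_def by auto
  qed
  have "q ` (R \<inter> W) \<subseteq> X - W" using q W(2) by (auto dest: inj_onD)
  moreover have "inj_on q (R \<inter> W)"
    using q W(2) by (intro inj_onI) (metis Int_iff inj_onD)
  ultimately have 1: "card (R \<inter> W) \<le> card (X - W)" using X by (intro card_inj_on_le) auto
  have 2: "card (R - W) \<le> card (X - W)" using X R by (intro card_mono) auto
  have "card R = card (R \<inter> W) + card (R - W)"
    using X R by (metis card_Int_Diff finite_subset)
  with 1 2 R(2) have "card X \<le> 4 * card (X - W)" by linarith
  moreover have "X - (X - W) = W" using W(1) by blast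
  then have "f ` (X - W) \<subseteq> f ` (X - (X - W))" using W(3) by auto
  ultimately show ?thesis using that[of "X - W"] by blast
qed

text \<open>Union bound over the absorbed sets \<open>Z\<close> with at least \<open>k / 4\<close>
  elements. There are at most \<open>2 ^ k\<close> of them, and each is absorbed with probability at
  most \<open>1 / 256 ^ card Z\<close>, hence at most \<open>1 / 4 ^ k\<close>, since
  \<open>256 = 4 ^ 4\<close>.\<close>

lemma card_colliding_maps_le:
  fixes N :: nat
  assumes X: "X \<subseteq> {..<N}" "card X = k" and R: "R \<subseteq> X" "k \<le> 2 * card R"
  defines "F \<equiv> {..<N} \<rightarrow>\<^sub>E {..<256 * k}"
  shows "card {f \<in> F. \<forall>x\<in>R. collides f X x} * 2 ^ k \<le> card F"
proof -
  have finX: "finite X" using X finite_subset by blast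
  let ?Zs = "{Z. Z \<subseteq> X \<and> k \<le> 4 * card Z}"
  let ?B = "\<lambda>Z. {f \<in> F. f ` Z \<subseteq> f ` (X - Z)}"
  have finF: "finite F" unfolding F_def by (intro finite_PiE) auto
  have cardF: "card F = (256 * k) ^ N" unfolding F_def by (simp add: card_PiE)
  have finZs: "finite ?Zs" using finX by auto
  have B: "card (?B Z) * 4 ^ k \<le> card F" if "Z \<in> ?Zs" for Z
  proof -
    have zN: "card Z \<le> N"
      using that X by (metis (mono_tags, lifting) card_lessThan card_mono finite_lessThan mem_Collect_eq order_trans)
    have "card (?B Z) * 4 ^ k \<le> card (?B Z) * 256 ^ card Z"
    proof -
      have "(4::nat) ^ k \<le> 4 ^ (4 * card Z)" using that by (intro power_increasing) auto
      also have "\<dots> = 256 ^ card Z" by (simp add: power_mult)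
      finally show ?thesis by simp
    qed
    also have "\<dots> \<le> (256 * k) ^ (N - card Z) * k ^ card Z * 256 ^ card Z"
      using card_maps_absorbed_le[OF X(1), of Z "256 * k"] that X(2) unfolding F_def by auto
    also have "\<dots> = (256 * k) ^ (N - card Z) * (256 * k) ^ card Z"
      by (simp add: power_mult_distrib)
    also have "\<dots> = (256 * k) ^ (N - card Z + card Z)" by (rule power_add[symmetric])
    also have "\<dots> = card F" using zN by (simp add: cardF)
    finally show ?thesis .
  qed
  have four_power: "(4::nat) ^ k = 2 ^ k * 2 ^ k" by (simp flip: power_mult_distrib)
  have "card {f \<in> F. \<forall>x\<in>R. collides f X x} \<le> card (\<Union>Z\<in>?Zs. ?B Z)"
  proof (rule card_mono)
    show "finite (\<Union>Z\<in>?Zs. ?B Z)" using finF finZs by auto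
    show "{f \<in> F. \<forall>x\<in>R. collides f X x} \<subseteq> (\<Union>Z\<in>?Zs. ?B Z)"
    proof
      fix f assume f: "f \<in> {f \<in> F. \<forall>x\<in>R. collides f X x}"
      then obtain Z where "Z \<subseteq> X" "card X \<le> 4 * card Z" "f ` Z \<subseteq> f ` (X - Z)"
        using colliding_imp_absorbed[OF finX R(1)] R(2) X(2) by blast
      with f X(2) show "f \<in> (\<Union>Z\<in>?Zs. ?B Z)" by blast
    qed
  qed
  also have "\<dots> \<le> (\<Sum>Z\<in>?Zs. card (?B Z))" using finZs by (rule card_UN_le)
  finally have "card {f \<in> F. \<forall>x\<in>R. collides f X x} * 4 ^ k \<le> (\<Sum>Z\<in>?Zs. card (?B Z) * 4 ^ k)"
    by (simp flip: sum_distrib_right)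
  also have "\<dots> \<le> card ?Zs * card F" using B by (metis (no_types, lifting) of_nat_id sum_bounded_above)
  also have "\<dots> \<le> 2 ^ k * card F"
  proof -
    have "card ?Zs \<le> card (Pow X)" using finX by (intro card_mono) auto
    then show ?thesis using finX X(2) by (simp add: card_Pow)
  qed
  finally have "(card {f \<in> F. \<forall>x\<in>R. collides f X x} * 2 ^ k) * 2 ^ k \<le> card F * 2 ^ k"
    by (simp add: mult_ac four_power)
  then show ?thesis by simp
qed

text \<open>Read \<open>b f y\<close> as: \<open>f\<close> fails on \<open>y\<close>. On any subset
  of \<open>Y\<close> an average member of \<open>F\<close> fails on at most a fraction
  \<open>1 / q\<close>, so the maps can be chosen greedily, each one dividing the number of
  unsettled \<open>y\<close> by \<open>q\<close>.\<close>

lemma exists_fooling_few: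
  fixes q :: nat
  assumes "finite F" "F \<noteq> {}" "finite Y" and le: "\<And>y. y \<in> Y \<Longrightarrow> card {f \<in> F. b f y} * q \<le> card F"
  shows "\<exists>fs. length fs = L \<and> set fs \<subseteq> F \<and> card {y \<in> Y. \<forall>f\<in>set fs. b f y} * q ^ L \<le> card Y"
proof (induction L)
  case (Suc L)
  then obtain fs where fs: "length fs = L" "set fs \<subseteq> F"
    and IH: "card {y \<in> Y. \<forall>f\<in>set fs. b f y} * q ^ L \<le> card Y" by blast
  let ?Y = "{y \<in> Y. \<forall>f\<in>set fs. b f y}"
  have "\<exists>f\<in>F. card {y \<in> ?Y. b f y} * q \<le> card ?Y"
  proof (rule ccontr)
    assume "\<not> ?thesis"
    then have "(\<Sum>f\<in>F. card ?Y) < (\<Sum>f\<in>F. card {y \<in> ?Y. b f y} * q)"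
      using assms(1,2) by (intro sum_strict_mono) auto
    also have "\<dots> = (\<Sum>f\<in>F. \<Sum>y\<in>?Y. of_bool (b f y) * q)"
      using assms(3) by (intro sum.cong) (auto simp: sum_distrib_right Int_def simp flip: sum_distrib_right)
    also have "\<dots> = (\<Sum>y\<in>?Y. card {f \<in> F. b f y} * q)"
      using assms(1) by (subst sum.swap) (auto simp: Int_def simp flip: sum_distrib_right)
    also have "\<dots> \<le> (\<Sum>y\<in>?Y. card F)" using le by (intro sum_mono) auto
    finally show False by (simp add: mult.commute)
  qed
  then obtain f where f: "f \<in> F" "card {y \<in> ?Y. b f y} * q \<le> card ?Y" by blast
  have "{y \<in> Y. \<forall>f\<in>set (f # fs). b f y} = {y \<in> ?Y. b f y}" by auto
  then have "card {y \<in> Y. \<forall>f\<in>set (f # fs). b f y} * q ^ Suc L \<le> card ?Y * q ^ L"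
    using f(2) mult_le_mono1 by (simp add: mult.assoc[symmetric])
  also note IH
  finally show ?case using fs f by (intro exI[of _ "f # fs"]) auto
qed (auto intro: card_mono assms)

text \<open>A single term of the exponential series gives \<open>k ^ k / k! <= e ^ k\<close>, and
  \<open>e <= 3\<close>.\<close>

lemma power_self_le_fact: "k ^ k \<le> 4 ^ k * fact k" for k :: nat
proof -
  have "real k ^ k / fact k \<le> exp (real k)"
  proof -
    have "(\<Sum>i\<in>{k}. inverse (fact i) * real k ^ i) \<le> (\<Sum>i. inverse (fact i) * real k ^ i)"
      using summable_exp[of "real k"] by (intro sum_le_suminf) auto
    then show ?thesis by (simp add: exp_def divide_inverse mult.commute)
  qed
  also have "\<dots> \<le> 4 ^ k"
    using exp_le by (simp add: exp_of_nat_mult[of k 1, simplified] power_mono)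
  finally have "real (k ^ k) \<le> real (4 ^ k * fact k)" by (simp add: field_simps)
  then show ?thesis using of_nat_le_iff by blast
qed

text \<open>For \<open>N = 2 ^ J\<close> and \<open>k = 2 ^ K\<close> this is the estimate
  \<open>(N choose k) <= N ^ k / k! <= (4 * N / k) ^ k\<close>; the summand 2 in the exponent is the
  factor 4.\<close>

lemma binomial_two_powers_le:
  assumes "K \<le> J"
  shows "(2 ^ J choose 2 ^ K) \<le> 2 ^ ((J - K + 2) * 2 ^ K)"
proof -
  define k :: nat where "k = 2 ^ K"
  have J: "(2::nat) ^ J = 2 ^ (J - K) * k" using assms by (simp add: k_def flip: power_add)
  have "(2 ^ J choose k) * k ^ k \<le> (2 ^ J choose k) * (4 ^ k * fact k)"
    using power_self_le_fact by (intro mult_le_mono) auto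
  also have "\<dots> \<le> 4 ^ k * (2 ^ J) ^ k"
    using binomial_fact_pow[of "2 ^ J" k] by simp
  also have "\<dots> = 2 ^ ((J - K + 2) * k) * k ^ k"
  proof -
    have "(4::nat) ^ k = 2 ^ (2 * k)" by (simp add: power_mult)
    moreover have "((2::nat) ^ J) ^ k = 2 ^ ((J - K) * k) * k ^ k"
      by (simp add: J power_mult_distrib power_mult)
    moreover have "2 * k + (J - K) * k = (J - K + 2) * k" by (simp add: algebra_simps)
    ultimately show ?thesis by (metis mult.assoc power_add)
  qed
  finally show ?thesis by (simp add: k_def)
qed

text \<open>\<open>R\<close> stands for the rumors left after all of \<open>fs\<close> has been
  used: they collide under every member, so they must be fewer than half of \<open>2 ^ K\<close>.
  With \<open>k = 2 ^ K\<close> there are at most \<open>2 ^ ((J - K + 3) * k)\<close> pairs of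
  \<open>X\<close> and \<open>R\<close>, and each map settles all but a fraction
  \<open>1 / 2 ^ k\<close> of them; one map beyond \<open>J - K + 3\<close> leaves less than one
  pair.\<close>

lemma selector_exists:
  assumes "K \<le> J"
  obtains fs :: "(nat \<Rightarrow> nat) list" where "length fs = J - K + 4" "set fs \<subseteq> {..<2 ^ J} \<rightarrow>\<^sub>E {..<256 * 2 ^ K}"
    "\<And>X R. \<lbrakk>X \<subseteq> {..<2 ^ J}; card X = 2 ^ K; R \<subseteq> X; 2 ^ K \<le> 2 * card R\<rbrakk> \<Longrightarrow>
       \<exists>f\<in>set fs. \<exists>x\<in>R. \<not> collides f X x"
proof -
  define k :: nat where "k = 2 ^ K"
  define F where "F = ({..<2 ^ J} \<rightarrow>\<^sub>E {..<256 * k} :: (nat \<Rightarrow> nat) set)"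
  define Xs where "Xs = {X. X \<subseteq> {..<(2::nat) ^ J} \<and> card X = k}"
  define Y where "Y = (SIGMA X:Xs. {R. R \<subseteq> X \<and> k \<le> 2 * card R})"
  let ?b = "\<lambda>f (X, R). \<forall>x\<in>R. collides f X x"
  have finXs: "finite Xs" unfolding Xs_def by simp
  have finR: "finite {R. R \<subseteq> X \<and> k \<le> 2 * card R} \<and> card {R. R \<subseteq> X \<and> k \<le> 2 * card R} \<le> 2 ^ k"
    if "X \<in> Xs" for X
  proof -
    have "finite X" using that unfolding Xs_def using finite_subset by blast
    moreover have "card {R. R \<subseteq> X \<and> k \<le> 2 * card R} \<le> card (Pow X)"
      using \<open>finite X\<close> by (intro card_mono) auto
    ultimately show ?thesis using that by (simp add: Xs_def card_Pow)
  qed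
  have finY: "finite Y" unfolding Y_def using finXs finR by auto
  have "card Y \<le> (\<Sum>X\<in>Xs. 2 ^ k)"
  proof -
    have "card Y = (\<Sum>X\<in>Xs. card {R. R \<subseteq> X \<and> k \<le> 2 * card R})"
      unfolding Y_def using finXs finR by (intro card_SigmaI) auto
    also have "\<dots> \<le> (\<Sum>X\<in>Xs. 2 ^ k)" using finR by (intro sum_mono) blast
    finally show ?thesis .
  qed
  also have "\<dots> = (2 ^ J choose k) * 2 ^ k"
    unfolding Xs_def using n_subsets[of "{..<(2::nat) ^ J}" k] by simp
  also have "\<dots> \<le> 2 ^ ((J - K + 2) * k) * 2 ^ k"
    using binomial_two_powers_le[OF assms] by (simp add: k_def)
  also have "\<dots> < 2 ^ (k * (J - K + 4))"
  proof -
    have "(J - K + 2) * k + k < k * (J - K + 4)" by (simp add: algebra_simps k_def)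
    then show ?thesis by (simp flip: power_add)
  qed
  finally have small: "card Y < (2 ^ k) ^ (J - K + 4)" by (simp add: power_mult)
  have "finite F" unfolding F_def by (intro finite_PiE) auto
  moreover have "F \<noteq> {}" unfolding F_def k_def by (auto simp: PiE_eq_empty_iff lessThan_empty_iff)
  moreover have "card {f \<in> F. ?b f y} * 2 ^ k \<le> card F" if "y \<in> Y" for y
    using that card_colliding_maps_le[of _ "2 ^ J" k] unfolding F_def Y_def Xs_def by auto
  ultimately obtain fs where fs: "length fs = J - K + 4" "set fs \<subseteq> F"
    and "card {y \<in> Y. \<forall>f\<in>set fs. ?b f y} * (2 ^ k) ^ (J - K + 4) \<le> card Y"
    using exists_fooling_few[of F Y ?b "2 ^ k" "J - K + 4"] finY by blast
  with small have "card {y \<in> Y. \<forall>f\<in>set fs. ?b f y} = 0"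
    by (metis (no_types, lifting) One_nat_def Suc_leI leD le_trans mult_le_mono1 nat_mult_1
        bot_nat_0.not_eq_extremum)
  then have none: "{y \<in> Y. \<forall>f\<in>set fs. ?b f y} = {}" using finY by simp
  show ?thesis
  proof (rule that[OF fs(1)])
    fix X R :: "nat set"
    assume "X \<subseteq> {..<2 ^ J}" "card X = 2 ^ K" "R \<subseteq> X" "2 ^ K \<le> 2 * card R"
    then have "(X, R) \<in> Y" by (simp add: Y_def Xs_def k_def)
    with none show "\<exists>f\<in>set fs. \<exists>x\<in>R. \<not> collides f X x" by blast
  qed (use fs in \<open>simp add: F_def k_def\<close>)
qed

text \<open>\<open>X i\<close> is what still waits before step \<open>i\<close>, and the members of
  \<open>As ! i\<close> compete in that step. The removal of a lone competitor is demanded, while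
  further removals are left open, so \<open>X\<close> may depend on the run in any way.\<close>

definition thins :: "nat set list \<Rightarrow> (nat \<Rightarrow> nat set) \<Rightarrow> bool" where
  "thins As X \<longleftrightarrow>
     (\<forall>i<length As. X (Suc i) \<subseteq> X i \<and> (\<forall>x. As ! i \<inter> X i = {x} \<longrightarrow> x \<notin> X (Suc i)))"

lemma thins_append:
  assumes "thins (As @ Bs) X"
  shows "thins As X" "thins Bs (\<lambda>i. X (length As + i))"
proof -
  show "thins As X" unfolding thins_def
  proof (intro allI impI)
    fix i assume "i < length As"
    with assms show "X (Suc i) \<subseteq> X i \<and> (\<forall>x. As ! i \<inter> X i = {x} \<longrightarrow> x \<notin> X (Suc i))"
      unfolding thins_def by (auto simp: nth_append dest: spec[of _ i])
  qed
  show "thins Bs (\<lambda>i. X (length As + i))" unfolding thins_def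
  proof (intro allI impI)
    fix i assume "i < length Bs"
    with assms show "X (length As + Suc i) \<subseteq> X (length As + i) \<and>
      (\<forall>x. Bs ! i \<inter> X (length As + i) = {x} \<longrightarrow> x \<notin> X (length As + Suc i))"
      unfolding thins_def by (auto simp: nth_append dest: spec[of _ "length As + i"])
  qed
qed

lemma thins_antimono: "thins As X \<Longrightarrow> i \<le> j \<Longrightarrow> j \<le> length As \<Longrightarrow> X j \<subseteq> X i"
proof (induction j)
  case (Suc j)
  show ?case
  proof (cases "i = Suc j")
    case False
    then have "X j \<subseteq> X i" using Suc by simp
    moreover have "X (Suc j) \<subseteq> X j" using Suc.prems unfolding thins_def by auto
    ultimately show ?thesis by blast
  qed simp
qed simp

definition hash_pass :: "nat \<Rightarrow> (nat \<Rightarrow> nat) list \<Rightarrow> nat set list" where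
  "hash_pass m fs = concat (map (\<lambda>f. map (\<lambda>b. {x. f x = b}) [0..<m]) fs)"

lemma length_hash_pass: "length (hash_pass m fs) = length fs * m"
  unfolding hash_pass_def by (induction fs) auto

lemma set_hash_pass: "f \<in> set fs \<Longrightarrow> b < m \<Longrightarrow> {x. f x = b} \<in> set (hash_pass m fs)"
  unfolding hash_pass_def by (simp, rule bexI[of _ f]) (auto intro: imageI)

text \<open>When the bucket of a survivor was called, it had company. The companion was already
  waiting at the beginning, so collisions can be measured against the fixed set \<open>X 0\<close>
  although \<open>X\<close> shrinks during the pass.\<close>

lemma hash_pass_survivors_collide:
  assumes "thins (hash_pass m fs) X" "x \<in> X (length (hash_pass m fs))" "f \<in> set fs" "f x < m"
  shows "collides f (X 0) x"
proof -
  obtain i where i: "i < length (hash_pass m fs)" "hash_pass m fs ! i = {y. f y = f x}"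
    using set_hash_pass[OF assms(3,4)] by (metis in_set_conv_nth)
  have x: "x \<in> X i" "x \<in> X (Suc i)"
    using assms(2) i(1) thins_antimono[OF assms(1), of i "length (hash_pass m fs)"]
      thins_antimono[OF assms(1), of "Suc i" "length (hash_pass m fs)"] by auto
  then have "{y. f y = f x} \<inter> X i \<noteq> {x}" using assms(1) i unfolding thins_def by metis
  then obtain y where "y \<in> X i" "y \<noteq> x" "f y = f x" using x by blast
  moreover have "X i \<subseteq> X 0" using thins_antimono[OF assms(1)] i(1) by auto
  ultimately show ?thesis unfolding collides_def by blast
qed

lemma halving_exists:
  assumes "K \<le> J"
  obtains As where "length As = (J - K + 4) * (256 * 2 ^ K)"
    "\<And>X. \<lbrakk>thins As X; X 0 \<subseteq> {..<2 ^ J}; card (X 0) \<le> 2 ^ K\<rbrakk> \<Longrightarrow> 2 * card (X (length As)) < 2 ^ K"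
proof -
  obtain fs :: "(nat \<Rightarrow> nat) list" where fs: "length fs = J - K + 4"
    "set fs \<subseteq> {..<2 ^ J} \<rightarrow>\<^sub>E {..<256 * 2 ^ K}"
    and sel: "\<And>X R. \<lbrakk>X \<subseteq> {..<2 ^ J}; card X = 2 ^ K; R \<subseteq> X; 2 ^ K \<le> 2 * card R\<rbrakk> \<Longrightarrow>
       \<exists>f\<in>set fs. \<exists>x\<in>R. \<not> collides f X x" using selector_exists[OF assms] by blast
  let ?As = "hash_pass (256 * 2 ^ K) fs"
  show ?thesis
  proof (rule that[of ?As])
    show "length ?As = (J - K + 4) * (256 * 2 ^ K)" by (simp add: length_hash_pass fs)
    fix X assume X: "thins ?As X" "X 0 \<subseteq> {..<2 ^ J}" "card (X 0) \<le> 2 ^ K"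
    let ?R = "X (length ?As)"
    have R: "?R \<subseteq> X 0" using thins_antimono[OF X(1)] by blast
    \<comment> \<open>The selector speaks of sets with exactly \<open>2 ^ K\<close> elements.
      Padding is harmless: a collision inside \<open>X 0\<close> is also one inside
      \<open>X'\<close>.\<close>
    obtain X' where X': "X 0 \<subseteq> X'" "X' \<subseteq> {..<2 ^ J}" "card X' = 2 ^ K"
      using exists_subset_between[of "X 0" "2 ^ K" "{..<2 ^ J}"] X assms by auto
    show "2 * card ?R < 2 ^ K"
    proof (rule ccontr)
      assume "\<not> ?thesis"
      then obtain f x where fx: "f \<in> set fs" "x \<in> ?R" "\<not> collides f X' x"
        using sel[of X' ?R] X' R by force
      have "f x < 256 * 2 ^ K" using fx fs(2) R X(2) by blast
      then have "collides f (X 0) x" using hash_pass_survivors_collide[OF X(1) fx(2,1)] by blast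
      then show False using fx(3) X'(1) unfolding collides_def by blast
    qed
  qed
qed

text \<open>The bound is summable over \<open>K\<close>: all resolution sequences together take time linear in \<open>2 ^ J\<close>.\<close>

lemma resolution_exists:
  assumes "K \<le> J"
  shows "\<exists>As. length As \<le> 512 * (2 ^ K * (J - K + 5)) \<and>
    (\<forall>X. thins As X \<longrightarrow> X 0 \<subseteq> {..<2 ^ J} \<longrightarrow> card (X 0) \<le> 2 ^ K \<longrightarrow> X (length As) = {})"
  using assms
proof (induction K)
  case 0
  have "X (Suc 0) = {}" if "thins [UNIV] X" "X 0 \<subseteq> {..<2 ^ J}" "card (X 0) \<le> 1" for X
  proof -
    have "finite (X 0)" using that(2) finite_subset by blast
    then have "X 0 = {} \<or> (\<exists>x. X 0 = {x})" using that(3) by (metis card_1_singletonE card_eq_0_iff le_0_eq le_SucE One_nat_def)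
    then show ?thesis using that(1) unfolding thins_def by auto
  qed
  then show ?case by (intro exI[of _ "[UNIV]"]) auto
next
  case (Suc K)
  then obtain Bs where Bs: "length Bs \<le> 512 * (2 ^ K * (J - K + 5))"
    "\<And>X. \<lbrakk>thins Bs X; X 0 \<subseteq> {..<2 ^ J}; card (X 0) \<le> 2 ^ K\<rbrakk> \<Longrightarrow> X (length Bs) = {}" by auto
  obtain As where As: "length As = (J - Suc K + 4) * (256 * 2 ^ Suc K)"
    "\<And>X. \<lbrakk>thins As X; X 0 \<subseteq> {..<2 ^ J}; card (X 0) \<le> 2 ^ Suc K\<rbrakk> \<Longrightarrow> 2 * card (X (length As)) < 2 ^ Suc K"
    using halving_exists[OF Suc.prems] by blast
  obtain d where d: "J = Suc K + d" using Suc.prems le_Suc_ex by blast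
  \<comment> \<open>The offset 5 is chosen for this recursion:
    \<open>(d + 4) + (d + 6) = 2 * (d + 5)\<close>, so the bound for \<open>Suc K\<close> is met
    exactly.\<close>
  have "length (As @ Bs) \<le> 512 * (2 ^ Suc K * (J - Suc K + 5))"
    using As(1) Bs(1) by (simp add: d algebra_simps)
  moreover have "X (length (As @ Bs)) = {}"
    if X: "thins (As @ Bs) X" "X 0 \<subseteq> {..<2 ^ J}" "card (X 0) \<le> 2 ^ Suc K" for X
  proof -
    have "card (X (length As)) \<le> 2 ^ K" using As(2)[OF thins_append(1)[OF X(1)] X(2,3)] by simp
    moreover have "X (length As) \<subseteq> {..<2 ^ J}"
      using thins_antimono[OF X(1), of 0 "length As"] X(2) by auto
    ultimately show ?thesis using Bs(2)[OF thins_append(2)[OF X(1)]] by simp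
  qed
  ultimately show ?case by blast
qed

text \<open>The nodes must agree on the sequence without communicating; a choice that depends on
  \<open>J\<close> and \<open>K\<close> alone is common knowledge.\<close>

definition resolution :: "nat \<Rightarrow> nat \<Rightarrow> nat set list" where
  "resolution J K = (SOME As. length As \<le> 512 * (2 ^ K * (J - K + 5)) \<and>
    (\<forall>X. thins As X \<longrightarrow> X 0 \<subseteq> {..<2 ^ J} \<longrightarrow> card (X 0) \<le> 2 ^ K \<longrightarrow> X (length As) = {}))"

lemma resolution:
  assumes "K \<le> J"
  shows "length (resolution J K) \<le> 512 * (2 ^ K * (J - K + 5))"
    and "\<lbrakk>thins (resolution J K) X; X 0 \<subseteq> {..<2 ^ J}; card (X 0) \<le> 2 ^ K\<rbrakk> \<Longrightarrow>
           X (length (resolution J K)) = {}"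
  using someI_ex[OF resolution_exists[OF assms]] unfolding resolution_def by blast+

subsection \<open>The protocol\<close>

text \<open>A field must be able to hold \<open>n\<close> itself, the subtree size of the root, and
  \<open>n\<close> may equal \<open>2 ^ ceillog2 n\<close>; hence the extra bit.\<close>

definition width :: "nat \<Rightarrow> nat" where
  "width n = Suc (ceillog2 n)"

definition encode :: "nat \<Rightarrow> nat \<Rightarrow> nat \<Rightarrow> bool list" where
  "encode n x z = map (bit x) [0..<width n] @ map (bit z) [0..<width n]"

definition decode :: "nat \<Rightarrow> bool list \<Rightarrow> nat \<times> nat" where
  "decode n bs = (horner_sum of_bool 2 (take (width n) bs), horner_sum of_bool 2 (drop (width n) bs))"

lemma length_encode: "length (encode n x z) = 2 * width n"
  by (simp add: encode_def)

lemma decode_encode: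
  assumes "x \<le> n" "z \<le> n"
  shows "decode n (encode n x z) = (x, z)"
proof -
  have "horner_sum of_bool 2 (map (bit y) [0..<width n]) = y" if "y \<le> n" for y :: nat
  proof -
    have "y \<le> 2 ^ ceillog2 n" using that le_two_power_ceillog2 le_trans by blast
    also have "\<dots> < 2 ^ width n" by (simp add: width_def)
    finally have "y < 2 ^ width n" .
    then show ?thesis by (simp add: horner_sum_bit_eq_take_bit take_bit_nat_eq_self)
  qed
  with assms show ?thesis by (simp add: decode_def encode_def)
qed

datatype slot = Contend nat "nat set" | Flow nat

text \<open>In the flow a node starts after at most \<open>2 ^ K\<close> steps and then sends at
  most \<open>2 ^ K\<close> rumors at two steps each, whence \<open>3 * 2 ^ K\<close>; the 2 is
  slack that keeps later inequalities strict.\<close>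

definition stage :: "nat \<Rightarrow> nat \<Rightarrow> slot list" where
  "stage J K = map (Contend K) (resolution J K) @ replicate (3 * 2 ^ K + 2) (Flow K)"

definition stages :: "nat \<Rightarrow> nat \<Rightarrow> slot list" where
  "stages J K = concat (map (stage J) [0..<K])"

abbreviation schedule :: "nat \<Rightarrow> slot list" where
  "schedule n \<equiv> stages (ceillog2 n) (Suc (ceillog2 n))"

text \<open>The default slot has an empty label set, so that everybody is silent after the
  schedule.\<close>

definition slot_at :: "nat \<Rightarrow> nat \<Rightarrow> slot" where
  "slot_at n t = (if t - n < length (schedule n) then schedule n ! (t - n) else Contend 0 {})"

text \<open>Rumors are named by the labels of their origins, since the rumors themselves need not be
  distinct. A node with \<open>waiting = 0\<close> has heard the subtree size of each child, and then \<open>load\<close> is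
  its own subtree size; \<open>wake\<close> is the step after the last of these reports.\<close>

record 'r node_state =
  waiting :: nat
  load :: nat
  wake :: nat
  held :: "nat \<Rightarrow> 'r payload option"
  reported :: bool

definition initial :: "nat \<Rightarrow> 'r node_state" where
  "initial l = \<lparr>waiting = 0, load = 1, wake = 0, held = [l \<mapsto> Own_Rumor], reported = False\<rparr>"

text \<open>A node of unknown size is silent. Classes below \<open>K\<close> speak in
  \<open>Contend K\<close>, class \<open>K\<close> in \<open>Flow K\<close>; doubling replaces the
  division in the definition of the classes. The parity condition lets a node send at steps
  \<open>wake\<close>, \<open>wake + 2\<close> and so on, which leaves the steps between for
  receiving.\<close>

definition ready :: "slot \<Rightarrow> nat \<Rightarrow> 'r node_state \<Rightarrow> nat set" where
  "ready sl t s =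
     (if waiting s \<noteq> 0 then {}
      else case sl of
        Contend K A \<Rightarrow> if 2 * load s \<le> 2 ^ K then A \<inter> dom (held s) else {}
      | Flow K \<Rightarrow>
          if load s \<le> 2 ^ K \<and> 2 ^ K < 2 * load s \<and> even (t + wake s) then dom (held s) else {})"

definition pick :: "nat \<Rightarrow> nat \<Rightarrow> 'r node_state \<Rightarrow> nat option" where
  "pick n t s =
     (if ready (slot_at n t) t s = {} then None else Some (SOME x. x \<in> ready (slot_at n t) t s))"

text \<open>A size field \<open>0\<close> means that the sender has already reported its size.\<close>

definition action :: "nat \<Rightarrow> nat \<Rightarrow> nat \<Rightarrow> 'r node_state \<Rightarrow> 'r action" where
  "action n l t s =
     (if t < n then if l = t then Transmit No_Rumor [] else Receive
      else case pick n t s of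
        None \<Rightarrow> Receive
      | Some x \<Rightarrow> Transmit (the (held s x)) (encode n x (if reported s then 0 else load s)))"

text \<open>An acknowledgement does not say what was sent, so the label is recomputed by
  \<open>pick\<close> from the unchanged state. Each first report overwrites \<open>wake\<close>, so
  the last one determines it.\<close>

definition update :: "nat \<Rightarrow> nat \<Rightarrow> 'r node_state \<Rightarrow> 'r feedback \<Rightarrow> 'r node_state" where
  "update n t s fb =
     (if t < n then
        case fb of Heard (Some m) \<Rightarrow> s\<lparr>waiting := Suc (waiting s)\<rparr> | _ \<Rightarrow> s
      else case fb of
        Heard (Some (Some y, bs)) \<Rightarrow>
          (case decode n bs of (x, z) \<Rightarrow>
            if z = 0 then s\<lparr>held := (held s)(x \<mapsto> Relay y)\<rparr>
            else s\<lparr>held := (held s)(x \<mapsto> Relay y), waiting := waiting s - 1,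
                   load := load s + z, wake := Suc t\<rparr>)
      | Ack True \<Rightarrow> s\<lparr>held := (held s)(the (pick n t s) := None), reported := True\<rparr>
      | _ \<Rightarrow> s)"

definition state_of :: "nat \<Rightarrow> nat \<Rightarrow> 'r feedback list \<Rightarrow> 'r node_state" where
  "state_of n l fs = foldl (\<lambda>s (t, fb). update n t s fb) (initial l) (enumerate 0 fs)"

definition gather :: "'r protocol" where
  "gather n l fs = action n l (length fs) (state_of n l fs)"

lemma state_of_Nil [simp]: "state_of n l [] = initial l"
  by (simp add: state_of_def)

lemma state_of_snoc [simp]: "state_of n l (fs @ [fb]) = update n (length fs) (state_of n l fs) fb"
  by (simp add: state_of_def enumerate_append_eq)

lemma length_history [simp]: "length (history P n E lab \<rho> t v) = t"
  by (induction t) auto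

lemma rumors_at_Suc: "x \<in> rumors_at P n E lab \<rho> t v \<Longrightarrow> x \<in> rumors_at P n E lab \<rho> (Suc t) v"
  unfolding rumors_at_def by auto

lemma pick_SomeD: "pick n t s = Some x \<Longrightarrow> x \<in> ready (slot_at n t) t s"
  unfolding pick_def by (auto split: if_splits intro: someI)

lemma ready_subset_held: "ready sl t s \<subseteq> dom (held s)"
  unfolding ready_def by (auto split: slot.splits)

subsection \<open>Runs on a tree\<close>

locale network =
  fixes n :: nat and V :: "'v set" and E :: "('v \<times> 'v) set" and r :: 'v
    and lab :: "'v \<Rightarrow> nat" and \<rho> :: "'v \<Rightarrow> 'r"
  assumes radio_network: "radio_network n V E r lab"
begin

lemma finite_V: "finite V" and r_in: "r \<in> V" and E_sub: "E \<subseteq> V \<times> V" and r_out: "(r, w) \<notin> E"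
  and parent: "v \<in> V \<Longrightarrow> v \<noteq> r \<Longrightarrow> \<exists>!w. (v, w) \<in> E" and to_root: "v \<in> V \<Longrightarrow> (v, r) \<in> E\<^sup>*"
  and card_V: "card V = n" and inj_lab: "inj_on lab V" and lab_less: "v \<in> V \<Longrightarrow> lab v < n"
  using radio_network unfolding radio_network_def rooted_tree_def by (auto simp: Domain_iff)

lemma edgeD: "(v, w) \<in> E \<Longrightarrow> v \<in> V" "(v, w) \<in> E \<Longrightarrow> w \<in> V"
  using E_sub by auto

lemma parent_unique: "(v, w) \<in> E \<Longrightarrow> (v, w') \<in> E \<Longrightarrow> w = w'"
  using parent edgeD r_out by metis

text \<open>Since parents are unique, whoever is reachable from a node on a cycle can also return to
  it. The root is reachable but has no outgoing edge.\<close>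

lemma no_cycle: "(x, x) \<notin> E\<^sup>+"
proof
  assume x: "(x, x) \<in> E\<^sup>+"
  have "(y, x) \<in> E\<^sup>+" if "(x, y) \<in> E\<^sup>*" for y
    using that
  proof (induction rule: rtrancl_induct)
    case (step y z)
    from tranclD[OF step.IH] obtain z' where "(y, z') \<in> E" "(z', x) \<in> E\<^sup>*" by blast
    with step parent_unique have "(z, x) \<in> E\<^sup>*" by blast
    from this x show ?case by (rule rtrancl_trancl_trancl)
  qed (rule x)
  moreover have "x \<in> V" using tranclD[OF x] edgeD by blast
  ultimately have "(r, x) \<in> E\<^sup>+" using to_root by blast
  then show False using tranclD r_out by metis
qed

section \<open>Subtrees and their sizes\<close>

definition below :: "'v \<Rightarrow> 'v set" where "below v = {u. (u, v) \<in> E\<^sup>*}"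

definition children :: "'v \<Rightarrow> 'v set" where "children v = {c. (c, v) \<in> E}"

definition size_of :: "'v \<Rightarrow> nat" where "size_of v = card (below v)"

lemma below_self [simp]: "v \<in> below v"
  by (simp add: below_def)

lemma below_V: "v \<in> V \<Longrightarrow> below v \<subseteq> V"
  unfolding below_def by (auto elim: converse_rtranclE dest: edgeD)

lemma finite_below: "v \<in> V \<Longrightarrow> finite (below v)"
  using below_V finite_V finite_subset by blast

lemma below_child: "(c, v) \<in> E \<Longrightarrow> u \<in> below c \<Longrightarrow> u \<in> below v"
  unfolding below_def by auto

lemma child_below: "(c, v) \<in> E \<Longrightarrow> v \<in> below w \<Longrightarrow> c \<in> below w"
  unfolding below_def by (auto intro: converse_rtrancl_into_rtrancl)

lemma parent_not_below: "(c, v) \<in> E \<Longrightarrow> v \<notin> below c"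
  unfolding below_def using no_cycle by (auto intro: rtrancl_into_trancl1)

lemma below_rec: "below v = insert v (\<Union>c\<in>children v. below c)"
  unfolding below_def children_def by (auto elim: rtranclE intro: rtrancl_into_rtrancl)

lemma children_V: "children v \<subseteq> V"
  unfolding children_def using edgeD by blast

lemma finite_children: "finite (children v)"
  using children_V finite_V finite_subset by blast

text \<open>The ancestors of \<open>u\<close> form a chain because \<open>E\<close> is
  single-valued. If one of two siblings were an ancestor of the other, their parent would lie on a
  cycle.\<close>

lemma below_disjoint:
  assumes "(c, v) \<in> E" "(c', v) \<in> E" "u \<in> below c" "u \<in> below c'"
  shows "c = c'"
proof (rule ccontr)
  have *: False if "(a, v) \<in> E" "(b, v) \<in> E" "(a, b) \<in> E\<^sup>*" "a \<noteq> b" for a b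
  proof -
    from that(3,4) obtain w where "(a, w) \<in> E" "(w, b) \<in> E\<^sup>*" by (auto elim: converse_rtranclE)
    with that(1,2) parent_unique have "(v, v) \<in> E\<^sup>+" by (metis rtrancl_into_trancl1)
    then show False using no_cycle by blast
  qed
  assume "c \<noteq> c'"
  have "single_valued E" using parent_unique by (auto intro: single_valuedI)
  then have "(c, c') \<in> E\<^sup>* \<or> (c', c) \<in> E\<^sup>*"
    using assms(3,4) unfolding below_def using single_valued_confluent[of E u c c'] by blast
  then show False using * assms(1,2) \<open>c \<noteq> c'\<close> by blast
qed

lemma size_rec: "v \<in> V \<Longrightarrow> size_of v = Suc (\<Sum>c\<in>children v. size_of c)"
proof -
  assume v: "v \<in> V"
  have "v \<notin> (\<Union>c\<in>children v. below c)" using parent_not_below by (auto simp: children_def)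
  moreover have "card (\<Union>c\<in>children v. below c) = (\<Sum>c\<in>children v. size_of c)"
    unfolding size_of_def using finite_children finite_below children_V below_disjoint
    by (intro card_UN_disjoint) (auto simp: children_def)
  moreover have "finite (\<Union>c\<in>children v. below c)"
    using finite_children finite_below children_V by blast
  ultimately show ?thesis by (subst size_of_def, subst below_rec) simp
qed

lemma size_pos: "v \<in> V \<Longrightarrow> 0 < size_of v"
  using size_rec by simp

lemma size_child: "(c, v) \<in> E \<Longrightarrow> size_of c < size_of v"
  using size_rec[of v] member_le_sum[of c "children v" size_of] finite_children edgeD
  by (auto simp: children_def less_Suc_eq_le)

text \<open>The source of uniqueness within a class: two children with more than
  \<open>2 ^ K / 2\<close> nodes each force the parent above \<open>2 ^ K\<close>.\<close>

lemma size_two_children: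
  assumes "(c, v) \<in> E" "(c', v) \<in> E" "c \<noteq> c'"
  shows "size_of c + size_of c' < size_of v"
proof -
  have "(\<Sum>x\<in>{c, c'}. size_of x) \<le> (\<Sum>x\<in>children v. size_of x)"
    using assms finite_children by (intro sum_mono2) (auto simp: children_def)
  then show ?thesis using assms size_rec[of v] edgeD by simp
qed

lemma size_le: "v \<in> V \<Longrightarrow> size_of v \<le> n"
  using card_mono[OF finite_V below_V] card_V by (simp add: size_of_def)

section \<open>The run of the protocol and its invariant\<close>

abbreviation "hist \<equiv> history gather n E lab \<rho>"

definition st :: "nat \<Rightarrow> 'v \<Rightarrow> 'r node_state" where
  "st t v = state_of n (lab v) (hist t v)"

definition act :: "nat \<Rightarrow> 'v \<Rightarrow> 'r action" where
  "act t v = action n (lab v) t (st t v)"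

definition tx :: "nat \<Rightarrow> 'v \<Rightarrow> nat option" where
  "tx t v = pick n t (st t v)"

lemma gather_hist: "gather n (lab v) (hist t v) = act t v"
  by (simp add: gather_def act_def st_def)

lemma hist_Suc: "hist (Suc t) v = hist t v @ [feedback_of E \<rho> (act t) v]"
  by (simp add: gather_hist)

lemma st_0: "st 0 v = initial (lab v)"
  by (simp add: st_def)

lemma st_Suc: "st (Suc t) v = update n t (st t v) (feedback_of E \<rho> (act t) v)"
  by (simp add: st_def gather_hist)

text \<open>Labels are distinct, so step \<open>t\<close> has no other transmitter than the node
  labelled \<open>t\<close>. Nothing collides, and each parent counts its children; pings carry no
  rumor and leave the rest of the state alone.\<close>

lemma ping_phase:
  assumes "t \<le> n" "v \<in> V"
  shows "st t v = (initial (lab v))\<lparr>waiting := card {c \<in> children v. lab c < t}\<rparr>"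
  using assms
proof (induction t arbitrary: v)
  case 0
  then show ?case by (simp add: st_0 initial_def)
next
  case (Suc t)
  have t: "t < n" using Suc.prems by simp
  have a: "act t u = (if lab u = t then Transmit No_Rumor [] else Receive)" for u
    using t by (simp add: act_def action_def)
  have uniq: "u = u'" if "u \<in> V" "u' \<in> V" "lab u = t" "lab u' = t" for u u'
    using that inj_lab by (auto dest: inj_onD)
  show ?case
  proof (cases "\<exists>c\<in>children v. lab c = t")
    case True
    then obtain c where c: "(c, v) \<in> E" "lab c = t" by (auto simp: children_def)
    have "lab v \<noteq> t"
    proof
      assume "lab v = t"
      then have "c = v" using c(2) uniq edgeD[OF c(1)] by blast
      then show False using parent_not_below[OF c(1)] by simp
    qed
    then have d: "delivered E (act t) c v" using c a uniq edgeD by (auto simp: delivered_def)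
    then have "feedback_of E \<rho> (act t) v = Heard (Some (None, []))"
    proof -
      have "(THE u. delivered E (act t) u v) = c"
        using d by (intro the_equality) (auto simp: delivered_def)
      then show ?thesis using \<open>lab v \<noteq> t\<close> c d a by (auto simp: feedback_of_def)
    qed
    moreover have "{c \<in> children v. lab c < Suc t} = insert c {c \<in> children v. lab c < t}"
      using c uniq edgeD by (auto simp: children_def less_Suc_eq)
    ultimately show ?thesis
      using Suc t c finite_children by (simp add: st_Suc update_def)
  next
    case False
    then have "\<not> delivered E (act t) c v" for c using a by (auto simp: delivered_def children_def)
    then have "update n t (st t v) (feedback_of E \<rho> (act t) v) = st t v"
      using t a by (auto simp: feedback_of_def update_def)
    moreover have "{c \<in> children v. lab c < Suc t} = {c \<in> children v. lab c < t}"
      using False by (auto simp: less_Suc_eq)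
    ultimately show ?thesis using Suc by (simp add: st_Suc)
  qed
qed

definition moves :: "nat \<Rightarrow> 'v \<Rightarrow> 'v \<Rightarrow> nat \<Rightarrow> bool" where
  "moves t c v x \<longleftrightarrow> (c, v) \<in> E \<and> tx t c = Some x \<and> tx t v = None \<and>
     (\<forall>c'. (c', v) \<in> E \<and> tx t c' \<noteq> None \<longrightarrow> c' = c)"

definition H :: "nat \<Rightarrow> 'v \<Rightarrow> nat set" where
  "H t v = dom (held (st t v))"

text \<open>Two clauses drive the later arguments. A node that has not reported still holds its own
  rumor, so an empty node must have reported. And every label has exactly one holder: the
  acknowledgement makes the sender delete a rumor in the very step in which the parent stores
  it.\<close>

definition consistent :: "nat \<Rightarrow> bool" where
  "consistent t \<longleftrightarrow>
     (\<forall>v\<in>V. waiting (st t v) = card {c \<in> children v. \<not> reported (st t c)} \<and>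
        load (st t v) = Suc (\<Sum>c | c \<in> children v \<and> reported (st t c). size_of c) \<and>
        (reported (st t v) \<longrightarrow> waiting (st t v) = 0) \<and>
        (\<not> reported (st t v) \<longrightarrow> lab v \<in> H t v) \<and>
        (\<forall>x p. held (st t v) x = Some p \<longrightarrow>
           (\<exists>u\<in>below v. x = lab u \<and>
             (p = Own_Rumor \<and> \<rho> u = \<rho> v \<or> p = Relay (\<rho> u) \<and> \<rho> u \<in> rumors_at gather n E lab \<rho> t v)))) \<and>
     (\<forall>u\<in>V. \<exists>!v. v \<in> V \<and> lab u \<in> H t v)"

lemma act_Receive_iff: "n \<le> t \<Longrightarrow> act t v = Receive \<longleftrightarrow> tx t v = None"
  by (auto simp: act_def action_def tx_def split: option.splits)

lemma delivered_iff_moves: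
  "n \<le> t \<Longrightarrow> delivered E (act t) c v \<longleftrightarrow> (\<exists>x. moves t c v x)"
  by (auto simp: delivered_def moves_def act_Receive_iff)

lemma sole_sender_moves:
  assumes "(c, v) \<in> E" "tx t c \<noteq> None" "tx t v = None"
    "\<And>d. (d, v) \<in> E \<Longrightarrow> d \<noteq> c \<Longrightarrow> tx t d = None"
  shows "\<exists>x. moves t c v x"
proof -
  obtain x where "tx t c = Some x" using assms(2) by blast
  moreover have "d = c" if "(d, v) \<in> E \<and> tx t d \<noteq> None" for d
    using that assms(4) by (cases "d = c") auto
  ultimately show ?thesis using assms(1,3) unfolding moves_def by auto
qed

lemma moves_inj: "moves t c v x \<Longrightarrow> moves t c' v y \<Longrightarrow> c = c' \<and> x = y"
  unfolding moves_def by auto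

lemma moves_target: "moves t c v x \<Longrightarrow> moves t c w y \<Longrightarrow> v = w \<and> x = y"
  unfolding moves_def using parent_unique by auto

lemma tx_held: "tx t v = Some x \<Longrightarrow> x \<in> H t v"
  unfolding tx_def H_def using pick_SomeD ready_subset_held by blast

lemma tx_known: "tx t v = Some x \<Longrightarrow> waiting (st t v) = 0"
  unfolding tx_def using pick_SomeD by (fastforce simp: ready_def split: if_splits)

lemma moves_edge: "moves t c v x \<Longrightarrow> (c, v) \<in> E"
  and moves_held: "moves t c v x \<Longrightarrow> x \<in> H t c"
  unfolding moves_def using tx_held by auto

section \<open>A single step after the initial pings\<close>

context
  fixes t assumes t: "n \<le> t" and ok: "consistent t"
begin

lemma known_iff: "v \<in> V \<Longrightarrow> waiting (st t v) = 0 \<longleftrightarrow> (\<forall>c\<in>children v. reported (st t c))"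
  using ok finite_children by (auto simp: consistent_def)

lemma known_load:
  assumes "v \<in> V" "waiting (st t v) = 0"
  shows "load (st t v) = size_of v"
proof -
  have "{c. c \<in> children v \<and> reported (st t c)} = children v" using assms known_iff by auto
  then show ?thesis using ok assms size_rec[of v] by (simp add: consistent_def)
qed

lemma H_labels: "v \<in> V \<Longrightarrow> H t v \<subseteq> lab ` below v"
  using ok unfolding consistent_def H_def by blast

lemma payload:
  assumes "v \<in> V" "held (st t v) x = Some p"
  shows "\<exists>u\<in>below v. x = lab u \<and>
    (p = Own_Rumor \<and> \<rho> u = \<rho> v \<or> p = Relay (\<rho> u) \<and> \<rho> u \<in> rumors_at gather n E lab \<rho> t v)"
  using ok assms unfolding consistent_def by blast

lemma holder_unique:
  assumes "u \<in> V" "v \<in> V" "x \<in> H t u" "x \<in> H t v"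
  shows "u = v"
proof -
  obtain w where "w \<in> V" "x = lab w" using H_labels below_V assms by blast
  then show ?thesis using ok assms unfolding consistent_def by blast
qed

lemma act_Transmit:
  assumes "v \<in> V" "tx t v = Some x"
  obtains u where "u \<in> below v" "x = lab u"
    "act t v = Transmit (the (held (st t v) x)) (encode n x (if reported (st t v) then 0 else size_of v))"
    "the (held (st t v) x) = Own_Rumor \<and> \<rho> u = \<rho> v \<or>
     the (held (st t v) x) = Relay (\<rho> u) \<and> \<rho> u \<in> rumors_at gather n E lab \<rho> t v"
proof -
  have "x \<in> dom (held (st t v))" using tx_held[OF assms(2)] by (simp add: H_def)
  then obtain p where p: "held (st t v) x = Some p" by blast
  then obtain u where "u \<in> below v" "x = lab u" "p = Own_Rumor \<and> \<rho> u = \<rho> v \<or>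
     p = Relay (\<rho> u) \<and> \<rho> u \<in> rumors_at gather n E lab \<rho> t v"
    using ok assms(1) unfolding consistent_def by blast
  moreover have "act t v = Transmit p (encode n x (if reported (st t v) then 0 else size_of v))"
    using assms t p known_load[OF assms(1) tx_known[OF assms(2)]] by (simp add: act_def action_def tx_def)
  ultimately show ?thesis using that p by simp
qed

lemma st_moved_out:
  assumes "moves t v w x"
  shows "st (Suc t) v = (st t v)\<lparr>held := (held (st t v))(x := None), reported := True\<rparr>"
proof -
  have tx: "tx t v = Some x" using assms by (simp add: moves_def)
  moreover have "\<exists>w. delivered E (act t) v w" using assms delivered_iff_moves[OF t] by blast
  moreover have "act t v \<noteq> Receive" using tx act_Receive_iff[OF t] by simp
  ultimately have "feedback_of E \<rho> (act t) v = Ack True"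
    by (cases "act t v") (auto simp: feedback_of_def)
  then show ?thesis using t tx by (simp add: st_Suc update_def tx_def)
qed

lemma feedback_moved_in:
  assumes "moves t c v x"
  obtains u where "u \<in> below c" "x = lab u"
    "feedback_of E \<rho> (act t) v = Heard (Some (Some (\<rho> u), encode n x (if reported (st t c) then 0 else size_of c)))"
proof -
  have "c \<in> V" using edgeD(1)[OF moves_edge[OF assms]] .
  moreover have "tx t c = Some x" using assms by (simp add: moves_def)
  ultimately have c: "c \<in> V" "tx t c = Some x" .
  obtain u where u: "u \<in> below c" "x = lab u"
    "act t c = Transmit (the (held (st t c) x)) (encode n x (if reported (st t c) then 0 else size_of c))"
    "the (held (st t c) x) = Own_Rumor \<and> \<rho> u = \<rho> c \<or> the (held (st t c) x) = Relay (\<rho> u)"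
    using act_Transmit[OF c] by metis
  have d: "delivered E (act t) c v" using assms delivered_iff_moves[OF t] by blast
  then have "(THE u. delivered E (act t) u v) = c"
    using assms moves_inj delivered_iff_moves[OF t] by (intro the_equality) blast+
  moreover have "act t v = Receive" using assms act_Receive_iff[OF t] by (simp add: moves_def)
  ultimately have "feedback_of E \<rho> (act t) v = Heard (message_of (\<rho> c) (act t c))"
    using d by (auto simp: feedback_of_def)
  then show ?thesis using that[OF u(1,2)] u(3,4) by auto
qed

lemma st_moved_in:
  assumes "moves t c v x"
  obtains u where "u \<in> below c" "x = lab u" "\<rho> u \<in> rumors_at gather n E lab \<rho> (Suc t) v"
    "st (Suc t) v =
      (if reported (st t c) then (st t v)\<lparr>held := (held (st t v))(x \<mapsto> Relay (\<rho> u))\<rparr>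
       else (st t v)\<lparr>held := (held (st t v))(x \<mapsto> Relay (\<rho> u)), waiting := waiting (st t v) - 1,
              load := load (st t v) + size_of c, wake := Suc t\<rparr>)"
proof -
  let ?z = "if reported (st t c) then 0 else size_of c"
  have c: "c \<in> V" using assms moves_edge edgeD by blast
  obtain u where u: "u \<in> below c" "x = lab u"
    and f: "feedback_of E \<rho> (act t) v = Heard (Some (Some (\<rho> u), encode n x ?z))"
    using feedback_moved_in[OF assms] .
  have "x \<le> n" using u below_V[OF c] lab_less by (metis less_imp_le subsetD)
  then have "decode n (encode n x ?z) = (x, ?z)" using size_le[OF c] by (intro decode_encode) auto
  \<comment> \<open>Subtree sizes are positive, so the field of a first report is never mistaken for
    the mark \<open>0\<close>.\<close>
  with f size_pos[OF c] t show ?thesis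
    by (intro that[OF u]) (auto simp: st_Suc update_def rumors_at_def hist_Suc simp del: history.simps)
qed

lemma st_unmoved:
  assumes "\<And>w x. \<not> moves t v w x" "\<And>c x. \<not> moves t c v x"
  shows "st (Suc t) v = st t v"
proof -
  have "delivered E (act t) v = (\<lambda>_. False)" "\<And>c. \<not> delivered E (act t) c v"
    using assms delivered_iff_moves[OF t] by blast+
  then show ?thesis
    using t by (simp add: st_Suc update_def feedback_of_def split: action.splits)
qed

lemma not_moves_both: "moves t c v x \<Longrightarrow> \<not> moves t v w y"
  unfolding moves_def by auto

text \<open>A node never sends and receives in the same step, so at most one of the two sets is
  nonempty, and it is then a singleton.\<close>

lemma H_Suc: "H (Suc t) v = (H t v - {x. \<exists>w. moves t v w x}) \<union> {x. \<exists>c. moves t c v x}"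
proof -
  consider (out) w x where "moves t v w x" | (into) c x where "moves t c v x"
    | (none) "\<And>w x. \<not> moves t v w x" "\<And>c x. \<not> moves t c v x" by blast
  then show ?thesis
  proof cases
    case out
    then have "{x. \<exists>w. moves t v w x} = {x}" "{x. \<exists>c. moves t c v x} = {}"
      using moves_target not_moves_both by blast+
    then show ?thesis using st_moved_out[OF out] by (simp add: H_def)
  next
    case into
    then have "{x. \<exists>w. moves t v w x} = {}" "{x. \<exists>c. moves t c v x} = {x}"
      using moves_inj not_moves_both by blast+
    moreover obtain y where "held (st (Suc t) v) = (held (st t v))(x \<mapsto> y)"
      by (rule st_moved_in[OF into]) (auto split: if_splits)
    ultimately show ?thesis by (auto simp: H_def)
  next
    case none
    then show ?thesis using st_unmoved[OF none] by (simp add: H_def)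
  qed
qed

lemma reported_Suc: "reported (st (Suc t) v) \<longleftrightarrow> reported (st t v) \<or> (\<exists>w x. moves t v w x)"
proof -
  consider (out) w x where "moves t v w x" | (into) c x where "moves t c v x"
    | (none) "\<And>w x. \<not> moves t v w x" "\<And>c x. \<not> moves t c v x" by blast
  then show ?thesis
  proof cases
    case out
    then show ?thesis using st_moved_out[OF out] by auto
  next
    case into
    have "reported (st (Suc t) v) = reported (st t v)"
      by (rule st_moved_in[OF into]) (auto split: if_splits)
    then show ?thesis using not_moves_both[OF into] by blast
  next
    case none
    then show ?thesis using st_unmoved[OF none] by simp
  qed
qed

lemma reported_child_Suc:
  "c \<in> children v \<Longrightarrow> reported (st (Suc t) c) \<longleftrightarrow> reported (st t c) \<or> (\<exists>x. moves t c v x)"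
  using reported_Suc moves_edge parent_unique by (metis children_def mem_Collect_eq)

lemma waiting_load_Suc:
  assumes "v \<in> V"
  shows "waiting (st (Suc t) v) = card {c \<in> children v. \<not> reported (st (Suc t) c)} \<and>
    load (st (Suc t) v) = Suc (\<Sum>c | c \<in> children v \<and> reported (st (Suc t) c). size_of c)"
proof -
  have old: "waiting (st t v) = card {c \<in> children v. \<not> reported (st t c)}"
    "load (st t v) = Suc (\<Sum>c | c \<in> children v \<and> reported (st t c). size_of c)"
    using ok assms by (auto simp: consistent_def)
  show ?thesis
  proof (cases "\<exists>c x. moves t c v x \<and> \<not> reported (st t c)")
    case True
    then obtain c x where c: "moves t c v x" "\<not> reported (st t c)" by blast
    have cv: "c \<in> children v" using moves_edge[OF c(1)] by (simp add: children_def)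
    have iff: "reported (st (Suc t) d) \<longleftrightarrow> reported (st t d) \<or> d = c" if "d \<in> children v" for d
      using reported_child_Suc[OF that] moves_inj c(1) by metis
    have "{d \<in> children v. \<not> reported (st (Suc t) d)} = {d \<in> children v. \<not> reported (st t d)} - {c}"
      using iff by blast
    moreover have "{d. d \<in> children v \<and> reported (st (Suc t) d)} =
        insert c {d. d \<in> children v \<and> reported (st t d)}"
      using iff cv by blast
    moreover have "waiting (st (Suc t) v) = waiting (st t v) - 1 \<and>
        load (st (Suc t) v) = load (st t v) + size_of c"
      by (rule st_moved_in[OF c(1)]) (simp add: c(2))
    ultimately show ?thesis using old c(2) cv finite_children by simp
  next
    case False
    then have iff: "reported (st (Suc t) d) \<longleftrightarrow> reported (st t d)" if "d \<in> children v" for d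
      using reported_child_Suc[OF that] by blast
    have "waiting (st (Suc t) v) = waiting (st t v) \<and> load (st (Suc t) v) = load (st t v)"
    proof -
      consider (out) w x where "moves t v w x" | (into) c x where "moves t c v x"
        | (none) "\<And>w x. \<not> moves t v w x" "\<And>c x. \<not> moves t c v x" by blast
      then show ?thesis
      proof cases
        case into
        show ?thesis by (rule st_moved_in[OF into]) (use False into in auto)
      qed (simp_all add: st_moved_out st_unmoved)
    qed
    moreover have "{d \<in> children v. \<not> reported (st (Suc t) d)} = {d \<in> children v. \<not> reported (st t d)}"
      "{d. d \<in> children v \<and> reported (st (Suc t) d)} = {d. d \<in> children v \<and> reported (st t d)}"
      using iff by blast+
    ultimately show ?thesis using old by simp
  qed
qed

text \<open>Once all children have reported, later arrivals have size field \<open>0\<close> and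
  leave \<open>wake\<close> alone. The parity at which a node sends is thus fixed before it first
  sends a rumor.\<close>

lemma known_Suc:
  assumes "v \<in> V" "waiting (st t v) = 0"
  shows "waiting (st (Suc t) v) = 0" "wake (st (Suc t) v) = wake (st t v)"
proof -
  have rep: "reported (st t c)" if "moves t c v x" for c x
    using known_iff assms moves_edge[OF that] by (auto simp: children_def)
  have "waiting (st (Suc t) v) = 0 \<and> wake (st (Suc t) v) = wake (st t v)"
  proof -
    consider (out) w x where "moves t v w x" | (into) c x where "moves t c v x"
      | (none) "\<And>w x. \<not> moves t v w x" "\<And>c x. \<not> moves t c v x" by blast
    then show ?thesis
    proof cases
      case into
      then show ?thesis using rep assms by (auto intro: st_moved_in[OF into])
    qed (simp_all add: st_moved_out st_unmoved assms)
  qed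
  then show "waiting (st (Suc t) v) = 0" "wake (st (Suc t) v) = wake (st t v)" by auto
qed

lemma payload_Suc:
  assumes "v \<in> V" "held (st (Suc t) v) x = Some p"
  shows "\<exists>u\<in>below v. x = lab u \<and>
    (p = Own_Rumor \<and> \<rho> u = \<rho> v \<or> p = Relay (\<rho> u) \<and> \<rho> u \<in> rumors_at gather n E lab \<rho> (Suc t) v)"
proof -
  have old: ?thesis if "held (st t v) x = Some p"
    using payload[OF assms(1) that] rumors_at_Suc by metis
  consider (out) w y where "moves t v w y" | (into) c y where "moves t c v y"
    | (none) "\<And>w y. \<not> moves t v w y" "\<And>c y. \<not> moves t c v y" by blast
  then show ?thesis
  proof cases
    case out
    then show ?thesis using assms(2) old st_moved_out[OF out] by (auto split: if_splits)
  next
    case into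
    obtain u where u: "u \<in> below c" "y = lab u" "\<rho> u \<in> rumors_at gather n E lab \<rho> (Suc t) v"
      and s: "st (Suc t) v = (if reported (st t c) then (st t v)\<lparr>held := (held (st t v))(y \<mapsto> Relay (\<rho> u))\<rparr>
       else (st t v)\<lparr>held := (held (st t v))(y \<mapsto> Relay (\<rho> u)), waiting := waiting (st t v) - 1,
              load := load (st t v) + size_of c, wake := Suc t\<rparr>)"
      by (rule st_moved_in[OF into])
    from s have "held (st (Suc t) v) = (held (st t v))(y \<mapsto> Relay (\<rho> u))" by simp
    note u = u this
    then show ?thesis
      using assms(2) old below_child[OF moves_edge[OF into]] by (auto split: if_splits)
  next
    case none
    then show ?thesis using assms(2) old st_unmoved[OF none] by simp
  qed
qed

lemma holder_Suc:
  assumes "u \<in> V"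
  shows "\<exists>!v. v \<in> V \<and> lab u \<in> H (Suc t) v"
proof -
  obtain v where v: "v \<in> V" "lab u \<in> H t v" using ok assms unfolding consistent_def by blast
  have new: "w \<in> V \<and> lab u \<in> H (Suc t) w \<longleftrightarrow>
      moves t v w (lab u) \<or> w = v \<and> (\<nexists>w'. moves t v w' (lab u))" for w
  proof -
    have "c = v" if "moves t c w (lab u)" for c
      using holder_unique[OF _ v(1) moves_held[OF that] v(2)] edgeD moves_edge[OF that] by blast
    moreover have "w = v" if "w \<in> V" "lab u \<in> H t w" using holder_unique that v by blast
    moreover have "w \<in> V" if "moves t v w (lab u)" using moves_edge[OF that] edgeD by blast
    ultimately show ?thesis unfolding H_Suc using v by blast
  qed
  show ?thesis
  proof (cases "\<exists>w. moves t v w (lab u)")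
    case True
    then obtain w where "moves t v w (lab u)" by blast
    then show ?thesis unfolding new using moves_target by blast
  next
    case False
    then show ?thesis unfolding new by blast
  qed
qed

lemma consistent_Suc: "consistent (Suc t)"
proof -
  have "reported (st (Suc t) v) \<longrightarrow> waiting (st (Suc t) v) = 0" if "v \<in> V" for v
  proof
    assume "reported (st (Suc t) v)"
    then consider "reported (st t v)" | w x where "moves t v w x" using reported_Suc by blast
    then have "waiting (st t v) = 0"
    proof cases
      case 1
      then show ?thesis using ok that unfolding consistent_def by blast
    next
      case 2
      then show ?thesis using tx_known unfolding moves_def by blast
    qed
    then show "waiting (st (Suc t) v) = 0" using known_Suc that by blast
  qed
  moreover have "\<not> reported (st (Suc t) v) \<longrightarrow> lab v \<in> H (Suc t) v" if "v \<in> V" for v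
  proof
    assume un: "\<not> reported (st (Suc t) v)"
    then have "lab v \<in> H t v" using ok that reported_Suc unfolding consistent_def by blast
    then show "lab v \<in> H (Suc t) v" using un reported_Suc H_Suc by blast
  qed
  ultimately show ?thesis
    unfolding consistent_def
    apply (intro conjI ballI)
    subgoal using waiting_load_Suc by blast
    subgoal using waiting_load_Suc by blast
    subgoal by blast
    subgoal by blast
    subgoal by (intro allI impI payload_Suc)
    subgoal by (rule holder_Suc)
    done
qed

end

lemma consistent_start: "consistent n"
proof -
  have s: "st n v = (initial (lab v))\<lparr>waiting := card (children v)\<rparr>" if "v \<in> V" for v
  proof -
    have "{c \<in> children v. lab c < n} = children v" using lab_less children_V by blast
    then show ?thesis using ping_phase[of n v] that by simp
  qed
  then have H: "H n v = {lab v}" if "v \<in> V" for v using that by (simp add: H_def initial_def)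
  have un: "\<not> reported (st n v)" if "v \<in> V" for v using s that by (simp add: initial_def)
  have "{c \<in> children v. \<not> reported (st n c)} = children v"
    "(\<Sum>c | c \<in> children v \<and> reported (st n c). size_of c) = 0" for v
    using un children_V by (blast, intro sum.neutral, blast)
  moreover have "\<exists>!v. v \<in> V \<and> lab u \<in> H n v" if "u \<in> V" for u
    using that H inj_lab by (auto dest: inj_onD)
  ultimately show ?thesis
    using s H un below_self unfolding consistent_def by (auto simp: initial_def split: if_splits)
qed

lemma consistent: "n \<le> t \<Longrightarrow> consistent t"
  by (induction t rule: dec_induct) (use consistent_start consistent_Suc in auto)

lemma unreported_start: "v \<in> V \<Longrightarrow> \<not> reported (st n v)"
  using ping_phase[of n v] by (simp add: initial_def)


section \<open>Contention within a stage\<close>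

definition quiet :: "nat \<Rightarrow> nat \<Rightarrow> bool" where
  "quiet K t \<longleftrightarrow> (\<forall>c v. (c, v) \<in> E \<longrightarrow> 2 * size_of v \<le> 2 ^ K \<longrightarrow> H t c = {})"

text \<open>\<open>quiet K\<close> and \<open>fresh K\<close> form the invariant at the beginning of
  stage \<open>K\<close>: nodes of class below \<open>K\<close> have drained everything beneath
  them, and nodes of class \<open>K\<close> or above have not yet delivered a rumor.\<close>

definition fresh :: "nat \<Rightarrow> nat \<Rightarrow> bool" where
  "fresh K t \<longleftrightarrow> (\<forall>v\<in>V. 2 ^ K < 2 * size_of v \<longrightarrow> \<not> reported (st t v))"

lemma unreported_held: "n \<le> t \<Longrightarrow> v \<in> V \<Longrightarrow> \<not> reported (st t v) \<Longrightarrow> lab v \<in> H t v"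
  using consistent unfolding consistent_def by blast

text \<open>The children are empty, and an unreported child would still hold its own rumor.\<close>

lemma quiet_known:
  assumes "n \<le> t" "quiet K t" "v \<in> V" "2 * size_of v \<le> 2 ^ K"
  shows "waiting (st t v) = 0"
proof -
  have "reported (st t c)" if "c \<in> children v" for c
    using that assms unreported_held[of t c] children_V unfolding quiet_def children_def by blast
  then show ?thesis using known_iff[OF assms(1) consistent] assms by blast
qed

lemma H_Suc_subset:
  assumes "n \<le> t" "\<And>c. (c, v) \<in> E \<Longrightarrow> tx t c = None"
  shows "H (Suc t) v \<subseteq> H t v"
  using assms H_Suc[OF assms(1) consistent[OF assms(1)]] by (auto simp: moves_def)

lemma quiet_no_tx: "quiet K t \<Longrightarrow> (c, v) \<in> E \<Longrightarrow> 2 * size_of v \<le> 2 ^ K \<Longrightarrow> tx t c = None"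
  using tx_held[of t c] unfolding quiet_def by (cases "tx t c") auto

lemma quiet_H_Suc:
  assumes "n \<le> t" "quiet K t" "2 * size_of v \<le> 2 ^ K"
  shows "H (Suc t) v \<subseteq> H t v"
  using assms quiet_no_tx by (intro H_Suc_subset) auto

lemma quiet_Suc:
  assumes "n \<le> t" "quiet K t"
  shows "quiet K (Suc t)"
  unfolding quiet_def
proof (intro allI impI)
  fix c v assume cv: "(c, v) \<in> E" "2 * size_of v \<le> 2 ^ K"
  then have "H t c = {}" using assms(2) unfolding quiet_def by blast
  moreover have "2 * size_of c \<le> 2 ^ K" using size_child[OF cv(1)] cv(2) by linarith
  ultimately show "H (Suc t) c = {}" using quiet_H_Suc[OF assms] by blast
qed

lemma quiet_mono:
  assumes "n \<le> t" "t \<le> t'" "quiet K t"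
  shows "quiet K t'"
  using assms(2) by (induction rule: dec_induct) (use assms in \<open>auto intro: quiet_Suc\<close>)

lemma known_mono:
  assumes "n \<le> t" "t \<le> t'" "v \<in> V" "waiting (st t v) = 0"
  shows "waiting (st t' v) = 0 \<and> wake (st t' v) = wake (st t v)"
  using assms(2)
proof (induction rule: dec_induct)
  case (step s)
  then have "n \<le> s" using assms(1) by simp
  then show ?case using step known_Suc[OF _ consistent assms(3)] by simp
qed (use assms in simp)

lemma unreported_mono:
  assumes "n \<le> t" "t \<le> t'" "\<And>s. t \<le> s \<Longrightarrow> s < t' \<Longrightarrow> tx s v = None" "\<not> reported (st t v)"
  shows "\<not> reported (st t' v)"
  using assms(2) assms(3)
proof (induction rule: dec_induct)
  case (step s)
  then have "\<not> reported (st s v)" "tx s v = None" "n \<le> s" using assms(1) by auto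
  then show ?case using reported_Suc[OF _ consistent] by (simp add: moves_def)
qed (use assms in simp)

lemma H_antimono:
  assumes "n \<le> t" "t \<le> t'" "\<And>s c. \<lbrakk>t \<le> s; s < t'; (c, v) \<in> E\<rbrakk> \<Longrightarrow> tx s c = None"
  shows "H t' v \<subseteq> H t v"
  using assms(2) assms(3)
proof (induction rule: dec_induct)
  case (step s)
  then have "H (Suc s) v \<subseteq> H s v" using assms(1) by (intro H_Suc_subset) auto
  with step show ?case by force
qed simp

lemma tx_known_ready:
  assumes "n \<le> t" "v \<in> V" "tx t v = Some x"
  shows "waiting (st t v) = 0" "load (st t v) = size_of v" "x \<in> ready (slot_at n t) t (st t v)"
  using assms tx_known known_load[OF _ consistent] pick_SomeD unfolding tx_def by blast+

lemma tx_Contend: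
  assumes "n \<le> t" "v \<in> V" "tx t v = Some x" "slot_at n t = Contend K A"
  shows "2 * size_of v \<le> 2 ^ K" "x \<in> A"
  using tx_known_ready[OF assms(1-3)] assms(4) by (auto simp: ready_def split: if_splits)

lemma tx_Flow:
  assumes "n \<le> t" "v \<in> V" "slot_at n t = Flow K"
  shows "tx t v \<noteq> None \<longleftrightarrow> waiting (st t v) = 0 \<and> size_of v \<le> 2 ^ K \<and> 2 ^ K < 2 * size_of v \<and>
    even (t + wake (st t v)) \<and> H t v \<noteq> {}"
  using assms(3) known_load[OF assms(1) consistent[OF assms(1)] assms(2)]
  by (auto simp: tx_def pick_def ready_def H_def)

definition light :: "nat \<Rightarrow> 'v \<Rightarrow> 'v set" where
  "light K v = {c \<in> children v. 2 * size_of c \<le> 2 ^ K}"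

text \<open>Nothing reaches a light child, since its own children are empty; so the waiting set only
  shrinks. In these slots \<open>v\<close> and any child of its class are silent. If a single
  waiting rumor is called, its holder is therefore the only sender and succeeds.\<close>

lemma thins_contention:
  assumes t0: "n \<le> t0" and q: "quiet K t0" and v: "v \<in> V" "2 ^ K < 2 * size_of v"
    and slots: "\<And>i. i < length As \<Longrightarrow> slot_at n (t0 + i) = Contend K (As ! i)"
  shows "thins As (\<lambda>i. \<Union>c\<in>light K v. H (t0 + i) c)"
  unfolding thins_def
proof (intro allI impI conjI)
  fix i assume i: "i < length As"
  define t where "t = t0 + i"
  have t: "n \<le> t" and qt: "quiet K t" using t0 q quiet_mono[of t0 t] by (auto simp: t_def)
  have sl: "slot_at n t = Contend K (As ! i)" using slots[OF i] by (simp add: t_def)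
  have dec: "H (Suc t) c \<subseteq> H t c" if "c \<in> light K v" for c
    using quiet_H_Suc[OF t qt] that by (simp add: light_def)
  then show "(\<Union>c\<in>light K v. H (t0 + Suc i) c) \<subseteq> (\<Union>c\<in>light K v. H (t0 + i) c)"
    by (auto simp: t_def)
  fix x assume x: "As ! i \<inter> (\<Union>c\<in>light K v. H (t0 + i) c) = {x}"
  then obtain c where c: "c \<in> light K v" "x \<in> H t c" "x \<in> As ! i" by (auto simp: t_def)
  have lightD: "(d, v) \<in> E" "d \<in> V" "2 * size_of d \<le> 2 ^ K" if "d \<in> light K v" for d
    using that edgeD by (auto simp: light_def children_def)
  have only: "d = c" if "d \<in> light K v" "x \<in> H t d" for d
    using holder_unique[OF t consistent[OF t] lightD(2)[OF that(1)] lightD(2)[OF c(1)] that(2) c(2)] .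
  have sub: "As ! i \<inter> H t d \<subseteq> {x}" if "d \<in> light K v" for d using x that by (auto simp: t_def)
  have known: "waiting (st t c) = 0" using quiet_known[OF t qt] lightD[OF c(1)] by blast
  have "ready (slot_at n t) t (st t c) = {x}"
    using known known_load[OF t consistent[OF t] lightD(2)[OF c(1)] known] lightD[OF c(1)] c sub[OF c(1)]
    by (auto simp: ready_def sl H_def)
  then have "tx t c = Some x" by (simp add: tx_def pick_def)
  moreover have "tx t v = None" using tx_Contend(1)[OF t v(1) _ sl] v(2) by fastforce
  moreover have "d = c" if d: "(d, v) \<in> E" "tx t d \<noteq> None" for d
  proof -
    obtain y where y: "tx t d = Some y" using d by blast
    have "d \<in> light K v" using tx_Contend(1)[OF t edgeD(1)[OF d(1)] y sl] d by (simp add: light_def children_def)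
    moreover have "y \<in> As ! i \<inter> H t d" using tx_Contend(2)[OF t edgeD(1)[OF d(1)] y sl] tx_held[OF y] by blast
    ultimately show ?thesis using only sub by blast
  qed
  ultimately have m: "moves t c v x" using lightD(1)[OF c(1)] unfolding moves_def by blast
  have "x \<notin> H (Suc t) d" if "d \<in> light K v" for d
  proof (cases "d = c")
    case True
    have "\<not> moves t e c y" for e y
      using quiet_no_tx[OF qt _ lightD(3)[OF c(1)], of e] by (auto simp: moves_def)
    then show ?thesis using m True H_Suc[OF t consistent[OF t], of c] by blast
  qed (use only dec that in blast)
  then show "x \<notin> (\<Union>c\<in>light K v. H (t0 + Suc i) c)" by (simp add: t_def)
qed

text \<open>The rumors waiting at light children originate below \<open>v\<close>, so there are at
  most \<open>size_of v\<close> of them, the load that \<open>resolution\<close> is built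
  for.\<close>

lemma contention_clears:
  assumes t0: "n \<le> t0" and q: "quiet K t0" and v: "v \<in> V" "2 ^ K < 2 * size_of v" "size_of v \<le> 2 ^ K"
    and J: "K \<le> ceillog2 n"
    and slots: "\<And>i. i < length (resolution (ceillog2 n) K) \<Longrightarrow>
      slot_at n (t0 + i) = Contend K (resolution (ceillog2 n) K ! i)"
    and c: "c \<in> light K v"
  shows "H (t0 + length (resolution (ceillog2 n) K)) c = {}"
proof -
  let ?X = "\<lambda>i. \<Union>c\<in>light K v. H (t0 + i) c"
  have sub: "?X 0 \<subseteq> lab ` below v"
  proof
    fix x assume "x \<in> ?X 0"
    then obtain d where d: "(d, v) \<in> E" "x \<in> H t0 d" by (auto simp: light_def children_def)
    then show "x \<in> lab ` below v"
      using H_labels[OF t0 consistent[OF t0] edgeD(1)[OF d(1)]] below_child[OF d(1)] by blast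
  qed
  have "card (?X 0) \<le> size_of v"
    using card_mono[OF _ sub] card_image_le[OF finite_below[OF v(1)], of lab] finite_below[OF v(1)]
    unfolding size_of_def by (meson finite_imageI le_trans)
  moreover have "?X 0 \<subseteq> {..<2 ^ ceillog2 n}"
  proof -
    have "lab ` below v \<subseteq> {..<n}" using below_V[OF v(1)] lab_less by blast
    moreover have "{..<n} \<subseteq> {..<2 ^ ceillog2 n}"
      using le_two_power_ceillog2 by (intro lessThan_subset_iff[THEN iffD2])
    ultimately show ?thesis using sub by (meson order_trans)
  qed
  ultimately have "?X (length (resolution (ceillog2 n) K)) = {}"
    using v(3) by (intro resolution(2)[OF J thins_contention[OF t0 q v(1,2) slots]]) linarith+
  with c show ?thesis by blast
qed


section \<open>Flow along the paths of class \<open>K\<close>, between the steps \<open>t1\<close>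
  and \<open>t2\<close>\<close>

definition mid :: "nat \<Rightarrow> 'v \<Rightarrow> bool" where
  "mid K v \<longleftrightarrow> v \<in> V \<and> size_of v \<le> 2 ^ K \<and> 2 ^ K < 2 * size_of v"

text \<open>During a flow, \<open>v\<close> starts at step \<open>f\<close> and then uses every second step until it runs empty.
  Its pauses are the steps in which its child on the path transmits; once idle it stays idle, since
  the child must have been idle in the step before.\<close>

definition streams :: "nat \<Rightarrow> nat \<Rightarrow> 'v \<Rightarrow> nat \<Rightarrow> bool" where
  "streams t1 t2 v f \<longleftrightarrow>
     (\<forall>t. t1 \<le> t \<longrightarrow> t < f \<longrightarrow> tx t v = None) \<and>
     \<not> reported (st f v) \<and>
     (\<forall>t. f \<le> t \<longrightarrow> t < t2 \<longrightarrow> (tx t v \<noteq> None \<longleftrightarrow> even (t - f) \<and> H t v \<noteq> {})) \<and>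
     (\<forall>t t'. f \<le> t \<longrightarrow> even (t - f) \<longrightarrow>
        H t v = {} \<longrightarrow> t \<le> t' \<longrightarrow> t' \<le> t2 \<longrightarrow> H t' v = {})"

context
  fixes K t1 t2 :: nat
  assumes t1: "n \<le> t1" and t2: "t1 + 3 * 2 ^ K < t2"
    and q: "quiet K t1" and fr: "fresh K t1"
    and slots: "\<And>t. t1 \<le> t \<Longrightarrow> t < t2 \<Longrightarrow> slot_at n t = Flow K"
    and cleared: "\<And>c v. mid K v \<Longrightarrow> c \<in> light K v \<Longrightarrow> H t1 c = {}"
begin

lemma flow_tx:
  assumes "t1 \<le> t" "t < t2" "v \<in> V"
  shows "tx t v \<noteq> None \<longleftrightarrow>
    mid K v \<and> waiting (st t v) = 0 \<and> even (t + wake (st t v)) \<and> H t v \<noteq> {}"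
  using tx_Flow[OF _ assms(3) slots[OF assms(1,2)]] t1 assms by (auto simp: mid_def)

lemma light_silent: "t1 \<le> t \<Longrightarrow> t < t2 \<Longrightarrow> c \<in> light K v \<Longrightarrow> tx t c = None"
  using flow_tx[of t c] children_V by (auto simp: light_def mid_def)

lemma light_empty: "mid K v \<Longrightarrow> c \<in> light K v \<Longrightarrow> t1 \<le> t \<Longrightarrow> H t c = {}"
proof -
  assume v: "mid K v" and c: "c \<in> light K v" and t: "t1 \<le> t"
  have "H t c \<subseteq> H t1 c"
  proof (rule H_antimono[OF t1 t])
    fix s d assume "t1 \<le> s" "(d, c) \<in> E"
    then show "tx s d = None"
      using c quiet_no_tx[OF quiet_mono[OF t1 _ q]] by (simp add: light_def)
  qed
  then show ?thesis using cleared[OF v c] by simp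
qed

lemma child_cases:
  assumes "mid K v" "(c, v) \<in> E"
  shows "c \<in> light K v \<or> mid K c"
  using assms size_child[OF assms(2)] edgeD[OF assms(2)]
  by (auto simp: light_def mid_def children_def)

lemma mid_child_unique:
  assumes "mid K v" "(c, v) \<in> E" "mid K c" "(d, v) \<in> E" "d \<noteq> c"
  shows "d \<in> light K v"
  using child_cases[OF assms(1,4)] size_two_children[OF assms(2,4)] assms by (auto simp: mid_def)

lemma light_reported:
  assumes "mid K v" "c \<in> light K v" "t1 \<le> t"
  shows "reported (st t c)"
  using unreported_held[of t c] light_empty[OF assms] t1 assms(3) assms(2) children_V
  by (auto simp: light_def)

lemma streams_held: "streams t1 t2 v f \<Longrightarrow> v \<in> V \<Longrightarrow> t1 \<le> f \<Longrightarrow> H f v \<noteq> {}"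
  using unreported_held[of f v] t1 by (auto simp: streams_def)

lemma streams_iff:
  "\<lbrakk>streams t1 t2 v f; f \<le> t; t < t2\<rbrakk> \<Longrightarrow> tx t v \<noteq> None \<longleftrightarrow> even (t - f) \<and> H t v \<noteq> {}"
  unfolding streams_def by blast

lemma streams_idle:
  "\<lbrakk>streams t1 t2 v f; f \<le> t; even (t - f); H t v = {}; t \<le> t'; t' \<le> t2\<rbrakk> \<Longrightarrow> H t' v = {}"
  unfolding streams_def by blast

text \<open>All children are light and have reported, so the node knows its size at
  \<open>t1\<close> and loses at most one step to parity. No child sends, so an empty node stays
  empty.\<close>

lemma streams_bottom:
  assumes v: "mid K v" and only_light: "children v \<subseteq> light K v"
  shows "\<exists>f. t1 \<le> f \<and> f \<le> t1 + size_of v \<and> streams t1 t2 v f"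
proof -
  have vV: "v \<in> V" and sv: "size_of v \<le> 2 ^ K" using v by (auto simp: mid_def)
  have known1: "waiting (st t1 v) = 0"
    using known_iff[OF t1 consistent[OF t1] vV] light_reported[OF v] only_light by blast
  define f where "f = (if even (t1 + wake (st t1 v)) then t1 else Suc t1)"
  have f: "t1 \<le> f" "f \<le> t1 + size_of v" using size_pos[OF vV] by (auto simp: f_def)
  have iff: "tx t v \<noteq> None \<longleftrightarrow> even (t + wake (st t1 v)) \<and> H t v \<noteq> {}" if "t1 \<le> t" "t < t2" for t
    using flow_tx[OF that vV] known_mono[OF t1 that(1) vV known1] v by simp
  have before: "tx t v = None" if "t1 \<le> t" "t < f" for t
  proof -
    have "t = t1" "odd (t1 + wake (st t1 v))" using that by (auto simp: f_def split: if_splits)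
    then show ?thesis using iff[of t1] t2 by auto
  qed
  have "\<not> reported (st f v)"
    using unreported_mono[OF t1 f(1) before] fr v by (auto simp: fresh_def mid_def)
  moreover have "tx t v \<noteq> None \<longleftrightarrow> even (t - f) \<and> H t v \<noteq> {}" if "f \<le> t" "t < t2" for t
  proof -
    have "even (f + wake (st t1 v))" by (auto simp: f_def)
    then have "even (t + wake (st t1 v)) \<longleftrightarrow> even (t - f)" using that(1) by presburger
    then show ?thesis using iff[of t] that f(1) by simp
  qed
  moreover have "H t' v = {}" if "f \<le> t" "H t v = {}" "t \<le> t'" "t' \<le> t2" for t t'
  proof -
    have "H t' v \<subseteq> H t v"
      using that f t1 light_silent[of _ _ v] only_light
      by (intro H_antimono) (auto simp: children_def)
    then show ?thesis using that by simp
  qed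
  ultimately show ?thesis using f before unfolding streams_def by blast
qed

text \<open>The report of \<open>c\<close> is the only one missing. It arrives at step
  \<open>g\<close>, when \<open>v\<close> is still silent, and so \<open>v\<close> starts at
  \<open>Suc g\<close>, at the parity opposite to \<open>c\<close>. If \<open>v\<close> is empty at
  a later step of its own parity, then \<open>c\<close> delivered nothing one step before; as
  nothing could have collided there, \<open>c\<close> was empty at its own sending step and stays
  so.\<close>

lemma streams_above:
  assumes v: "mid K v" and c: "mid K c" "(c, v) \<in> E"
    and g: "t1 \<le> g" "g \<le> t1 + size_of c" "streams t1 t2 c g"
  shows "streams t1 t2 v (Suc g)"
proof -
  have vV: "v \<in> V" "c \<in> V" using v c by (auto simp: mid_def)
  have glt: "Suc g < t2"
    using g(2) size_child[OF c(2)] v t2 by (auto simp: mid_def)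
  have others: "tx t d = None" if "(d, v) \<in> E" "d \<noteq> c" "t1 \<le> t" "t < t2" for d t
    using light_silent[of t d v] mid_child_unique[OF v c(2,1)] that by blast
  have unr_c: "\<not> reported (st t c)" if "t1 \<le> t" "t \<le> g" for t
    using that g(3) unreported_mono[OF t1, of t c] fr c(1)
    by (auto simp: fresh_def mid_def streams_def)
  have nk: "waiting (st t v) \<noteq> 0" if "t1 \<le> t" "t \<le> g" for t
    using known_iff[OF _ consistent vV(1), of t] unr_c[OF that] c(2) t1 that by (auto simp: children_def)
  have before: "tx t v = None" if "t1 \<le> t" "t < Suc g" for t
    using flow_tx[of t v] nk[of t] that vV glt by auto
  have mv: "\<exists>x. moves t c v x" if "t1 \<le> t" "t < t2" "tx t c \<noteq> None" "tx t v = None" for t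
    using sole_sender_moves[OF c(2) that(3,4)] others that(1,2) by blast
  have "H g c \<noteq> {}" using streams_held[OF g(3) vV(2) g(1)] .
  then have "tx g c \<noteq> None" using g(3) glt by (auto simp: streams_def)
  then obtain x where x: "moves g c v x" using mv[of g] before[of g] g(1) glt by auto
  have gn: "n \<le> g" "n \<le> Suc g" using t1 g(1) by auto
  have wk: "wake (st (Suc g) v) = Suc g"
    by (rule st_moved_in[OF gn(1) consistent[OF gn(1)] x]) (simp add: unr_c[OF g(1) order_refl])
  have "reported (st (Suc g) d)" if "d \<in> children v" for d
  proof (cases "d = c")
    case True
    then show ?thesis using x reported_Suc[OF gn(1) consistent[OF gn(1)]] by blast
  next
    case False
    then show ?thesis
      using that light_reported[OF v mid_child_unique[OF v c(2,1)], of d "Suc g"] g(1)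
      by (auto simp: children_def)
  qed
  then have kn: "waiting (st (Suc g) v) = 0"
    using known_iff[OF gn(2) consistent[OF gn(2)] vV(1)] by blast
  have iff: "tx t v \<noteq> None \<longleftrightarrow> even (t - Suc g) \<and> H t v \<noteq> {}" if "Suc g \<le> t" "t < t2" for t
  proof -
    have "even (t + Suc g) \<longleftrightarrow> even (t - Suc g)" using that(1) by presburger
    then show ?thesis
      using flow_tx[OF _ that(2) vV(1)] known_mono[OF gn(2) that(1) vV(1) kn] wk v that(1) g(1) by simp
  qed
  have unr: "\<not> reported (st (Suc g) v)"
    using unreported_mono[OF t1 _ before, of "Suc g"] fr v g(1) by (auto simp: fresh_def mid_def)
  moreover have "H t' v = {}"
    if t: "Suc g \<le> t" "even (t - Suc g)" "H t v = {}" "t \<le> t'" "t' \<le> t2" for t t'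
  proof -
    \<comment> \<open>At its first step \<open>v\<close> has not sent and still holds its own rumor,
      so there is a preceding sending step of \<open>c\<close> after \<open>g\<close>.\<close>
    have "t \<noteq> Suc g" using unreported_held[OF gn(2) vV(1) unr] t(3) by blast
    then obtain s where s: "t = Suc s" "g < s" using t(1) by (cases t) auto
    have par: "even (s - g)" using t(2) s by simp
    then have par': "odd (s - Suc g)" using s(2) by presburger
    have "tx s v = None" using iff[of s] s par' t by auto
    moreover have "\<not> moves s c v y" for y
    proof
      assume "moves s c v y"
      then have "y \<in> H (Suc s) v" using H_Suc[OF _ consistent, of s v] gn s by auto
      then show False using t(3) s by blast
    qed
    ultimately have "tx s c = None" using mv[of s] s t g(1) by (cases "tx s c") auto
    then have "H s c = {}" using streams_iff[OF g(3), of s] s t par by simp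
    then have empty: "H u c = {}" if "s \<le> u" "u \<le> t2" for u
      using streams_idle[OF g(3) _ par _ that] s by simp
    have "H t' v \<subseteq> H t v"
    proof (rule H_antimono)
      show "n \<le> t" "t \<le> t'" using t gn by auto
      fix u d assume u: "t \<le> u" "u < t'" "(d, v) \<in> E"
      show "tx u d = None"
      proof (cases "d = c")
        case True
        then show ?thesis using empty[of u] tx_held[of u c] u s t by (cases "tx u c") auto
      qed (use others u t g s in auto)
    qed
    then show ?thesis using t by simp
  qed
  ultimately show ?thesis using before iff unfolding streams_def by blast
qed

text \<open>Each level of the path delays the start by one step and adds at least one node to the
  subtree, so the delay is bounded by the size.\<close>

lemma streams_exist:
  "mid K v \<Longrightarrow> \<exists>f. t1 \<le> f \<and> f \<le> t1 + size_of v \<and> streams t1 t2 v f"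
proof (induction "size_of v" arbitrary: v rule: less_induct)
  case less
  show ?case
  proof (cases "children v \<subseteq> light K v")
    case True
    then show ?thesis using streams_bottom less.prems by blast
  next
    case False
    then obtain c where c: "(c, v) \<in> E" "mid K c"
      using child_cases[OF less.prems] by (auto simp: children_def)
    then obtain g where "t1 \<le> g" "g \<le> t1 + size_of c" "streams t1 t2 c g"
      using less.hyps size_child by blast
    moreover from this have "streams t1 t2 v (Suc g)" using streams_above less.prems c by blast
    ultimately show ?thesis using size_child[OF c(1)] by (intro exI[of _ "Suc g"]) auto
  qed
qed

text \<open>\<open>U t\<close> collects what is still held in the subtree of \<open>c\<close>.
  Nothing enters this subtree, and as long as \<open>c\<close> is nonempty at its sending steps,
  each of them takes one rumor out. Hence \<open>size_of c\<close> rounds of two steps suffice,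
  unless \<open>c\<close> ran empty earlier and remained so.\<close>

lemma flow_clears:
  assumes v: "mid K v" and c: "mid K c" "(c, v) \<in> E"
  shows "H t2 c = {}"
proof -
  obtain g where g: "t1 \<le> g" "g \<le> t1 + size_of c" "streams t1 t2 c g"
    using streams_exist[OF c(1)] by blast
  have sv: "streams t1 t2 v (Suc g)" using streams_above[OF v c g] .
  have cV: "c \<in> V" and sc: "size_of c \<le> 2 ^ K" using c(1) by (auto simp: mid_def)
  have end_le: "g + 2 * size_of c < t2" using g(2) sc t2 by linarith
  define U where "U t = (\<Union>u\<in>below c. H t u)" for t
  have finU: "finite (U t)" and cardU: "card (U t) \<le> size_of c" if tn: "n \<le> t" for t
  proof -
    have sub: "U t \<subseteq> lab ` below c"
    proof
      fix x assume "x \<in> U t"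
      then obtain u where u: "u \<in> below c" "x \<in> H t u" unfolding U_def by blast
      then obtain w where "w \<in> below u" "x = lab w"
        using H_labels[OF tn consistent[OF tn]] below_V[OF cV] by blast
      with u(1) show "x \<in> lab ` below c" unfolding below_def by (auto intro: rtrancl_trans)
    qed
    then show "finite (U t)" using finite_below[OF cV] finite_subset by blast
    show "card (U t) \<le> size_of c"
      using card_mono[OF _ sub] card_image_le[OF finite_below[OF cV], of lab] finite_below[OF cV]
      unfolding size_of_def by (meson finite_imageI le_trans)
  qed
  have U_dec: "U (Suc t) \<subseteq> U t" if tn: "n \<le> t" for t
  proof
    fix x assume "x \<in> U (Suc t)"
    then obtain u where u: "u \<in> below c" "x \<in> H (Suc t) u" unfolding U_def by blast
    then consider "x \<in> H t u" | d where "moves t d u x"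
      using H_Suc[OF tn consistent[OF tn]] by blast
    then show "x \<in> U t"
    proof cases
      case 2
      then show ?thesis using moves_held[OF 2] child_below[OF moves_edge[OF 2] u(1)] unfolding U_def by blast
    qed (use u in \<open>auto simp: U_def\<close>)
  qed
  have progress: "H (g + 2 * j) c = {} \<or> card (U (g + 2 * j)) + j \<le> size_of c" if "j \<le> size_of c" for j
    using that
  proof (induction j)
    case 0
    then show ?case using cardU[of g] t1 g(1) by simp
  next
    case (Suc j)
    let ?t = "g + 2 * j"
    have tn: "n \<le> ?t" "n \<le> Suc ?t" using t1 g(1) by auto
    have tlt: "Suc (Suc ?t) < t2" using end_le Suc.prems by linarith
    show ?case
    proof (cases "H ?t c = {}")
      case True
      then show ?thesis using streams_idle[OF g(3), of ?t "g + 2 * Suc j"] tlt by simp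
    next
      case False
      then have "tx ?t c \<noteq> None" using g(3) tlt by (simp add: streams_def)
      \<comment> \<open>At \<open>j = 0\<close> the parent has not started; afterwards it uses the
        other parity.\<close>
      moreover have "tx ?t v = None"
      proof (cases "j = 0")
        case False
        then have "Suc g \<le> ?t" "odd (?t - Suc g)" by (cases j; simp)+
        then show ?thesis using streams_iff[OF sv, of ?t] tlt by simp
      qed (use sv g(1) in \<open>auto simp: streams_def\<close>)
      moreover have "tx ?t d = None" if "(d, v) \<in> E" "d \<noteq> c" for d
        using light_silent[OF _ _ mid_child_unique[OF v c(2,1) that]] g(1) tlt by simp
      ultimately obtain x where x: "moves ?t c v x" using sole_sender_moves[OF c(2)] by blast
      have "x \<in> U ?t" using moves_held[OF x] unfolding U_def by auto
      moreover have "x \<notin> U (Suc ?t)"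
      proof
        assume "x \<in> U (Suc ?t)"
        then obtain u where u: "u \<in> below c" "x \<in> H (Suc ?t) u" unfolding U_def by blast
        have "x \<in> H (Suc ?t) v" using x H_Suc[OF tn(1) consistent[OF tn(1)]] by blast
        then have "u = v"
          using holder_unique[OF tn(2) consistent[OF tn(2)]] u below_V[OF cV] edgeD[OF c(2)] by blast
        then show False using u(1) parent_not_below[OF c(2)] by blast
      qed
      ultimately have "U (Suc ?t) \<subset> U ?t" using U_dec[OF tn(1)] by blast
      then have "card (U (Suc ?t)) < card (U ?t)" using finU[OF tn(1)] by (rule psubset_card_mono[rotated])
      moreover have "card (U (Suc (Suc ?t))) \<le> card (U (Suc ?t))"
        using U_dec[OF tn(2)] finU[OF tn(2)] by (rule card_mono[rotated])
      ultimately show ?thesis using Suc False by simp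
    qed
  qed
  have "H (g + 2 * size_of c) c = {}"
  proof (rule ccontr)
    assume ne: "H (g + 2 * size_of c) c \<noteq> {}"
    then have "card (U (g + 2 * size_of c)) = 0" using progress[of "size_of c"] by simp
    then have "U (g + 2 * size_of c) = {}" using finU[of "g + 2 * size_of c"] t1 g(1) by simp
    then show False using ne unfolding U_def by auto
  qed
  then show ?thesis using streams_idle[OF g(3), of "g + 2 * size_of c" t2] end_le by simp
qed

lemma flow_quiet: "quiet (Suc K) t2"
  unfolding quiet_def
proof (intro allI impI)
  fix c v assume cv: "(c, v) \<in> E" "2 * size_of v \<le> 2 ^ Suc K"
  have t12: "t1 \<le> t2" using t2 by simp
  show "H t2 c = {}"
  proof (cases "2 * size_of v \<le> 2 ^ K")
    case True
    then show ?thesis using quiet_mono[OF t1 t12 q] cv(1) unfolding quiet_def by blast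
  next
    case False
    then have v: "mid K v" using cv edgeD[OF cv(1)] by (simp add: mid_def)
    then show ?thesis using child_cases[OF v cv(1)] light_empty[OF v _ t12] flow_clears[OF v _ cv(1)] by blast
  qed
qed

end


section \<open>Composition of the stages\<close>

lemma slot_at_schedule: "i < length (schedule n) \<Longrightarrow> slot_at n (n + i) = schedule n ! i"
  by (simp add: slot_at_def)

lemma length_stage: "length (stage J K) = length (resolution J K) + (3 * 2 ^ K + 2)"
  by (simp add: stage_def)

lemma stage_flow: "j < 3 * 2 ^ K + 2 \<Longrightarrow> stage J K ! (length (resolution J K) + j) = Flow K"
  unfolding stage_def by (metis length_map nth_append_length_plus nth_replicate)

lemma stages_prefix: "K \<le> L \<Longrightarrow> \<exists>ys. stages J L = stages J K @ ys"
  using upt_add_eq_append[of 0 K "L - K"] unfolding stages_def by auto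

lemma stage_slots:
  assumes "K \<le> ceillog2 n" "i < length (stage (ceillog2 n) K)"
  shows "slot_at n (n + length (stages (ceillog2 n) K) + i) = stage (ceillog2 n) K ! i"
proof -
  obtain ys where "schedule n = stages (ceillog2 n) (Suc K) @ ys"
    using stages_prefix[of "Suc K" "Suc (ceillog2 n)"] assms(1) by auto
  then have "schedule n = stages (ceillog2 n) K @ stage (ceillog2 n) K @ ys"
    by (simp add: stages_def)
  then show ?thesis using assms(2) by (simp add: slot_at_schedule add.assoc nth_append)
qed

text \<open>Contention slots of stage \<open>K\<close> silence class \<open>K\<close> and above, so
  \<open>fresh K\<close> lasts until the flow; flow slots silence all classes above
  \<open>K\<close>, which gives \<open>fresh (Suc K)\<close>. At \<open>K = 0\<close> quietness is
  vacuous since sizes are positive.\<close>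

lemma stage_invariant:
  assumes "K \<le> Suc (ceillog2 n)"
  shows "quiet K (n + length (stages (ceillog2 n) K)) \<and> fresh K (n + length (stages (ceillog2 n) K))"
  using assms
proof (induction K)
  case 0
  have "\<not> 2 * size_of v \<le> 1" if "(c, v) \<in> E" for c v
    using size_pos[OF edgeD(2)[OF that]] by simp
  then show ?case using unreported_start by (auto simp: quiet_def fresh_def stages_def)
next
  case (Suc K)
  let ?J = "ceillog2 n"
  let ?As = "resolution ?J K"
  define t0 where "t0 = n + length (stages ?J K)"
  define t1 where "t1 = t0 + length ?As"
  define t2 where "t2 = t1 + (3 * 2 ^ K + 2)"
  have K: "K \<le> ?J" and q0: "quiet K t0" and f0: "fresh K t0" using Suc by (auto simp: t0_def)
  have le: "n \<le> t0" "t0 \<le> t1" "n \<le> t1" "t1 \<le> t2" by (auto simp: t0_def t1_def t2_def)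
  have slots: "slot_at n (t0 + i) = stage ?J K ! i" if "i < length (stage ?J K)" for i
    using stage_slots[OF K that] by (simp add: t0_def)
  have contend: "slot_at n (t0 + i) = Contend K (?As ! i)" if "i < length ?As" for i
    using slots[of i] that by (simp add: stage_def nth_append)
  have flow: "slot_at n t = Flow K" if tt: "t1 \<le> t" "t < t2" for t
  proof -
    obtain j where j: "t = t0 + (length ?As + j)" using le_Suc_ex[OF tt(1)] by (auto simp: t1_def add.assoc)
    then have "j < 3 * 2 ^ K + 2" using tt(2) by (simp add: t1_def t2_def)
    then show ?thesis using slots[of "length ?As + j"] stage_flow[of j K] by (simp add: j length_stage)
  qed
  have q1: "quiet K t1" using quiet_mono[OF le(1,2) q0] .
  have silent: "tx t v = None" if "t0 \<le> t" "t < t1" "v \<in> V" "2 ^ K < 2 * size_of v" for t v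
    using tx_Contend(1)[of t v _ K "?As ! (t - t0)"] contend[of "t - t0"] that le
    by (cases "tx t v") (auto simp: t1_def)
  have f1: "fresh K t1"
    unfolding fresh_def
  proof (intro ballI impI)
    fix v assume v: "v \<in> V" "2 ^ K < 2 * size_of v"
    show "\<not> reported (st t1 v)"
      using unreported_mono[OF le(1,2), of v] silent v f0 by (auto simp: fresh_def)
  qed
  have cleared: "H t1 c = {}" if "mid K v" "c \<in> light K v" for c v
    using contention_clears[OF le(1) q0 _ _ _ K contend that(2)] that(1) by (simp add: mid_def t1_def)
  have fl: "t1 + 3 * 2 ^ K < t2" by (simp add: t2_def)
  note flow_context = le(3) fl q1 f1 flow cleared
  have "fresh (Suc K) t2"
    unfolding fresh_def
  proof (intro ballI impI)
    fix v assume v: "v \<in> V" "2 ^ Suc K < 2 * size_of v"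
    have "tx t v = None" if "t1 \<le> t" "t < t2" for t
      using flow_tx[OF flow_context that v(1)] v(2) by (auto simp: mid_def)
    then show "\<not> reported (st t2 v)"
      using unreported_mono[OF le(3,4)] f1 v by (auto simp: fresh_def)
  qed
  moreover have "quiet (Suc K) t2" by (rule flow_quiet[OF flow_context])
  moreover have "n + length (stages ?J (Suc K)) = t2"
    by (simp add: stages_def stage_def t0_def t1_def t2_def)
  ultimately show ?case by simp
qed

text \<open>All sizes are at most \<open>2 ^ ceillog2 n\<close>, so after the last stage every node
  but the root is empty. Each label still has a holder, which must be the root.\<close>

lemma rumors_gathered:
  assumes "v \<in> V"
  shows "\<rho> v \<in> rumors_at gather n E lab \<rho> (n + length (schedule n)) r"
proof -
  let ?T = "n + length (schedule n)"
  have q: "quiet (Suc (ceillog2 n)) ?T" using stage_invariant by blast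
  have empty: "H ?T c = {}" if c: "c \<in> V" "c \<noteq> r" for c
  proof -
    obtain w where w: "(c, w) \<in> E" using parent[OF c] by blast
    have "size_of w \<le> 2 ^ ceillog2 n"
      using size_le[OF edgeD(2)[OF w]] le_two_power_ceillog2 le_trans by blast
    then show ?thesis using q w unfolding quiet_def by simp
  qed
  have ok: "consistent ?T" by (rule consistent) simp
  then obtain w where "w \<in> V" "lab v \<in> H ?T w" using assms unfolding consistent_def by blast
  then have "lab v \<in> H ?T r" using empty by blast
  then obtain p where "held (st ?T r) (lab v) = Some p" by (auto simp: H_def)
  then obtain u where u: "u \<in> below r" "lab v = lab u"
    "\<rho> u = \<rho> r \<or> \<rho> u \<in> rumors_at gather n E lab \<rho> ?T r"
    using payload[OF _ ok r_in] by (metis le_add1)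
  then have "u = v" using inj_lab assms below_V[OF r_in] by (auto dest: inj_onD)
  then show ?thesis using u(3) by (auto simp: rumors_at_def)
qed

lemma gather_admissible: "admissible gather (2 * width n) n V E lab \<rho>"
  unfolding admissible_def
proof (intro allI ballI impI)
  fix t v p bs
  assume v: "v \<in> V" and a: "gather n (lab v) (hist t v) = Transmit p bs"
  show "length bs \<le> 2 * width n \<and> (\<forall>x. p = Relay x \<longrightarrow> x \<in> rumors_at gather n E lab \<rho> t v)"
  proof (cases "t < n")
    case True
    then show ?thesis using a by (auto simp: gather_hist act_def action_def split: if_splits)
  next
    case False
    then have t: "n \<le> t" by simp
    then obtain x where x: "tx t v = Some x" using a act_Receive_iff[OF t, of v] by (auto simp: gather_hist)
    from act_Transmit[OF t consistent[OF t] v x] obtain u where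
      "act t v = Transmit (the (held (st t v) x)) (encode n x (if reported (st t v) then 0 else size_of v))"
      "the (held (st t v) x) = Own_Rumor \<or>
       the (held (st t v) x) = Relay (\<rho> u) \<and> \<rho> u \<in> rumors_at gather n E lab \<rho> t v"
      by metis
    then show ?thesis using a by (auto simp: gather_hist length_encode)
  qed
qed

end

subsection \<open>Running time\<close>

text \<open>The offset 6 makes the induction step exact:
  \<open>(d + 7) + (d + 5) = 2 * (d + 6)\<close>. At \<open>K = J\<close> the logarithmic factor has
  shrunk to a constant.\<close>

lemma sum_resolution_lengths_le:
  assumes "K \<le> J"
  shows "(\<Sum>i\<le>K. 2 ^ i * (J - i + 5)) \<le> 2 ^ Suc K * (J - K + 6)"
  using assms
proof (induction K)
  case (Suc K)
  obtain d where d: "J = Suc K + d" using Suc.prems le_Suc_ex by blast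
  have "(\<Sum>i\<le>K. 2 ^ i * (J - i + 5)) \<le> 2 ^ Suc K * (J - K + 6)" using Suc by simp
  then show ?case by (simp add: d algebra_simps)
qed simp

lemma length_schedule_le:
  assumes "0 < n"
  shows "length (schedule n) \<le> 20000 * n"
proof -
  let ?J = "ceillog2 n"
  have "length (schedule n) = (\<Sum>K\<le>?J. length (resolution ?J K) + (3 * 2 ^ K + 2))"
  proof -
    have "length (stages J m) = (\<Sum>K<m. length (resolution J K) + (3 * 2 ^ K + 2))" for J m
      by (induction m) (simp_all add: stages_def stage_def)
    then show ?thesis by (simp add: lessThan_Suc_atMost)
  qed
  also have "\<dots> \<le> (\<Sum>K\<le>?J. 513 * (2 ^ K * (?J - K + 5)))"
  proof (intro sum_mono)
    fix K assume "K \<in> {..?J}"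
    then have "length (resolution ?J K) \<le> 512 * (2 ^ K * (?J - K + 5))" using resolution(1) by simp
    \<comment> \<open>The flow costs no more than one further unit of the contention bound, hence
      513.\<close>
    moreover have "3 * 2 ^ K + 2 \<le> 2 ^ K * (5::nat)" using one_le_power[of "2::nat" K] by simp
    moreover have "2 ^ K * (5::nat) \<le> 2 ^ K * (?J - K + 5)" by (rule mult_le_mono2) simp
    ultimately show "length (resolution ?J K) + (3 * 2 ^ K + 2) \<le> 513 * (2 ^ K * (?J - K + 5))" by linarith
  qed
  also have "\<dots> \<le> 513 * (2 ^ Suc ?J * 6)"
    using sum_resolution_lengths_le[of ?J ?J] by (simp flip: sum_distrib_left)
  \<comment> \<open>\<open>2 ^ ?J < 2 * n\<close>, so \<open>513 * 24 * n = 12312 * n\<close> would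
    do.\<close>
  also have "\<dots> \<le> 20000 * n" using two_power_ceillog2_gt[OF assms] by simp
  finally show ?thesis .
qed

lemma width_bigo: "(\<lambda>n. real (2 * width n)) \<in> O(\<lambda>n. ln (real n))"
proof (rule bigoI[of _ 8])
  have "real (2 * width n) \<le> 8 * ln (real n)" if n: "3 \<le> n" for n
  proof -
    \<comment> \<open>The bound is \<open>2 * (log 2 n + 2) <= 4 * ln n + 4 <= 8 * ln n\<close>; the
      last step requires \<open>n >= e\<close>, whence the threshold 3.\<close>
    have "1 \<le> ln (real n)" using n exp_le by (simp add: ln_ge_iff)
    moreover have "real (ceillog2 n) < log 2 (real n) + 1" using n by (intro ceillog2_less_log) simp
    moreover have "log 2 (real n) \<le> 2 * ln (real n)"
    proof -
      have "1 / 2 \<le> ln (2::real)" using ln_le_minus_one[of "1 / 2"] by (simp add: ln_div)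
      then have "ln (real n) * (1 / 2) \<le> ln (real n) * ln 2"
        using \<open>1 \<le> ln (real n)\<close> by (intro mult_left_mono) auto
      then show ?thesis using \<open>1 / 2 \<le> ln 2\<close> by (simp add: log_def field_simps)
    qed
    ultimately show ?thesis by (simp add: width_def)
  qed
  then show "\<forall>\<^sub>F n in sequentially. norm (real (2 * width n)) \<le> 8 * norm (ln (real n))"
    by (intro eventually_sequentiallyI[of 3]) (auto intro: order_trans)
qed

theorem theorem2:
  shows "\<exists>(P :: 'r protocol) (B :: nat \<Rightarrow> nat) (T :: nat \<Rightarrow> nat).
    (\<lambda>n. real (B n)) \<in> O(\<lambda>n. ln (real n)) \<and>
    (\<lambda>n. real (T n)) \<in> O(\<lambda>n. real n) \<and>
    (\<forall>n (V :: 'v set) E r lab (\<rho> :: 'v \<Rightarrow> 'r).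
       radio_network n V E r lab \<longrightarrow>
         admissible P (B n) n V E lab \<rho> \<and>
         (\<forall>v\<in>V. \<rho> v \<in> rumors_at P n E lab \<rho> (T n) r))"
proof (intro exI conjI allI impI)
  show "(\<lambda>n. real (2 * width n)) \<in> O(\<lambda>n. ln (real n))" by (rule width_bigo)
  have "real (n + length (schedule n)) \<le> 20001 * real n" if "1 \<le> n" for n
    using length_schedule_le[of n] that by linarith
  then show "(\<lambda>n. real (n + length (schedule n))) \<in> O(\<lambda>n. real n)"
    by (intro bigoI[of _ 20001] eventually_sequentiallyI[of 1]) simp
next
  fix n r and V :: "'v set" and E lab and \<rho> :: "'v \<Rightarrow> 'r"
  assume "radio_network n V E r lab"
  then interpret network n V E r lab \<rho> by unfold_locales
  show "admissible gather (2 * width n) n V E lab \<rho>" by (rule gather_admissible)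
  show "\<forall>v\<in>V. \<rho> v \<in> rumors_at gather n E lab \<rho> (n + length (schedule n)) r"
    using rumors_gathered by blast
qed

end
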